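(* Let $k = 2r$ be a positive even integer and let $F$ be an infinite field whose characteristic does not divide $2(2r+1)\,r!$. Assume that $n > r$. Then for $A_1, A_2, \dots, A_k \in \mathrm{Mat}_n(F)$ in general position, the nullity of the linear operator $L(A_1,\dots,A_k)\colon \mathrm{Mat}_n(F)\to \mathrm{Mat}_n(F)$ is equal to $k$.
   Context: $\mathrm{Mat}_n(F)$ is the space of $n\times n$ matrices over $F$. The standard polynomial in $m$ variables is $[A_1,\dots,A_m]=\sum_{\sigma\in S_m}\operatorname{sgn}(\sigma)A_{\sigma(1)}\cdots A_{\sigma(m)}$. For $A_1,\dots,A_k\in \mathrm{Mat}_n(F)$, the linear operator $L(A_1,\dots,A_k)\colon \mathrm{Mat}_n(F)\to\mathrm{Mat}_n(F)$ is given by $L(A_1,\dots,A_k)(X)=[A_1,\dots,A_k,X]$. The nullity of a linear operator is the dimension of its kernel. "For $A_1,\dots,A_k$ in general position" means: for all $(A_1,\dots,A_k)$ in some nonempty Zariski open subset of the affine space $\mathrm{Mat}_n(F)^k$. *)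

theory Defs
  imports "HOL-Analysis.Analysis" "HOL-Combinatorics.Permutations"
begin

text \<open>
  The space \<open>Mat\<^sub>n(F)\<close> is \<open>'a ^ 'n ^ 'n\<close> with \<open>n = CARD('n)\<close>.  The instances \<open>(*)\<close> and \<open>1\<close> of this
  type are entrywise; the matrix product is \<open>(**)\<close> and its unit is \<open>mat 1\<close>.  A tuple
  \<open>(A\<^sub>1, \<dots>, A\<^sub>k)\<close> is a list of length \<open>k\<close>, so indices start at 0.
\<close>

definition mat_scale :: "'a::times \<Rightarrow> 'a ^ 'n ^ 'm \<Rightarrow> 'a ^ 'n ^ 'm"
  where "mat_scale c A = (\<chi> i j. c * A $ i $ j)"

interpretation mat_vs: vector_space "mat_scale :: 'a::field \<Rightarrow> 'a ^ 'n ^ 'm \<Rightarrow> 'a ^ 'n ^ 'm"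
  by unfold_locales (simp_all add: mat_scale_def vec_eq_iff algebra_simps)

definition mat_prod_list :: "('a::semiring_1 ^ 'n ^ 'n) list \<Rightarrow> 'a ^ 'n ^ 'n"
  where "mat_prod_list As = foldr (**) As (mat 1)"

definition standard_polynomial :: "('a::ring_1 ^ 'n ^ 'n) list \<Rightarrow> 'a ^ 'n ^ 'n"
  where "standard_polynomial As =
    (\<Sum>\<sigma> | \<sigma> permutes {..<length As}.
      mat_scale (of_int (sign \<sigma>)) (mat_prod_list (map (\<lambda>i. As ! \<sigma> i) [0..<length As])))"

definition L_op :: "('a::ring_1 ^ 'n ^ 'n) list \<Rightarrow> 'a ^ 'n ^ 'n \<Rightarrow> 'a ^ 'n ^ 'n"
  where "L_op As X = standard_polynomial (As @ [X])"

definition nullity :: "('a::field ^ 'n ^ 'n \<Rightarrow> 'a ^ 'n ^ 'n) \<Rightarrow> nat"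
  where "nullity f = mat_vs.dim {X. f X = 0}"

definition mat_tuples :: "nat \<Rightarrow> ('a ^ 'n ^ 'n) list set"
  where "mat_tuples k = {As. length As = k}"

text \<open>
  Polynomial functions on \<open>Mat\<^sub>n(F)\<^sup>k\<close>, in the \<open>k n\<^sup>2\<close> entries of the matrices.  Only the values
  on \<open>mat_tuples k\<close> are relevant.
\<close>

inductive_set mat_poly_fun :: "nat \<Rightarrow> (('a::comm_ring_1 ^ 'n ^ 'n) list \<Rightarrow> 'a) set"
  for k :: nat
  where
    const: "(\<lambda>As. c) \<in> mat_poly_fun k"
  | coord: "i < k \<Longrightarrow> (\<lambda>As. As ! i $ a $ b) \<in> mat_poly_fun k"
  | add: "p \<in> mat_poly_fun k \<Longrightarrow> q \<in> mat_poly_fun k \<Longrightarrow> (\<lambda>As. p As + q As) \<in> mat_poly_fun k"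
  | mult: "p \<in> mat_poly_fun k \<Longrightarrow> q \<in> mat_poly_fun k \<Longrightarrow> (\<lambda>As. p As * q As) \<in> mat_poly_fun k"

definition zariski_closed :: "nat \<Rightarrow> ('a::comm_ring_1 ^ 'n ^ 'n) list set \<Rightarrow> bool"
  where "zariski_closed k Z \<longleftrightarrow>
    (\<exists>S. S \<subseteq> mat_poly_fun k \<and> Z = {As \<in> mat_tuples k. \<forall>p\<in>S. p As = 0})"

definition zariski_open :: "nat \<Rightarrow> ('a::comm_ring_1 ^ 'n ^ 'n) list set \<Rightarrow> bool"
  where "zariski_open k U \<longleftrightarrow> U \<subseteq> mat_tuples k \<and> zariski_closed k (mat_tuples k - U)"

definition in_general_position ::
    "nat \<Rightarrow> (('a::comm_ring_1 ^ 'n ^ 'n) list \<Rightarrow> bool) \<Rightarrow> bool"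
  where "in_general_position k P \<longleftrightarrow> (\<exists>U. zariski_open k U \<and> U \<noteq> {} \<and> (\<forall>As\<in>U. P As))"

end

theory Submission
  imports Defs
begin

text \<open>
  The set where \<open>L(A\<^sub>1, \<dots>, A\<^sub>k)\<close> has nullity at most \<open>k\<close> contains a Zariski open set as soon as it is
  nonempty, and there the nullity is exactly \<open>k\<close>: by alternation the \<open>A\<^sub>i\<close> lie in the kernel, and they
  are independent unless \<open>L = 0\<close>.  So one tuple of nullity at most \<open>k = 2r\<close> is needed for every \<open>n > r\<close>.

  For \<open>n = r + 1\<close> take all \<open>n\<close> matrix units along an \<open>n\<close>-cycle together with \<open>n - 2\<close> generic diagonal
  matrices.  Every word uses each edge of the cycle once, so \<open>L\<close> maps diagonal matrices to diagonal
  matrices and each off-diagonal matrix unit to a multiple of itself.  That this multiple is nonzero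
  off the cycle, and that the diagonal block has rank at least 2, can be checked separately for
  diagonal matrices that are suitable matrix units, by counting Eulerian trails with sign.

  To pass from \<open>n\<close> to \<open>n + 1\<close>, border the matrices by zeros; this creates exactly one superfluous
  dimension in the kernel.  A perturbation of \<open>A\<^sub>1\<close> in the border removes it in second order, provided
  that \<open>S = [A\<^sub>1, \<dots>, A\<^sub>k]\<close> and \<open>T = [A\<^sub>2, \<dots>, A\<^sub>k]\<close> are invertible: the obstruction is
  \<open>2 \<rho> T S\<^sup>-\<^sup>1 T c\<close>, where \<open>c\<close> and \<open>\<rho>\<close> are the border column and row.  Since dimensions are types,
  the induction runs over subsets \<open>I\<close> of the index type and matrices supported on \<open>I \<times> I\<close>.
\<close>

abbreviation stp :: "('a::field ^ 'n ^ 'n) list \<Rightarrow> 'a ^ 'n ^ 'n"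
  where "stp \<equiv> standard_polynomial"

abbreviation del :: "nat \<Rightarrow> 'b list \<Rightarrow> 'b list"
  where "del i xs \<equiv> take i xs @ drop (Suc i) xs"

subsection \<open>Matrix algebra\<close>

lemma mat_scale_nth [simp]: "mat_scale c A $ i $ j = c * A $ i $ j"
  by (simp add: mat_scale_def)

lemma mat_eqI: "(\<And>i j. A $ i $ j = B $ i $ j) \<Longrightarrow> A = B"
  by (simp add: vec_eq_iff)

lemma mat_mul_nth: "(A ** B) $ i $ j = (\<Sum>k\<in>UNIV. A $ i $ k * B $ k $ j)"
  by (simp add: matrix_matrix_mult_def)

lemma mat_mul_zero_left [simp]: "(0 :: 'a::semiring_1 ^ 'n ^ 'm) ** A = 0"
  by (simp add: vec_eq_iff mat_mul_nth)

lemma mat_mul_zero_right [simp]: "A ** (0 :: 'a::semiring_1 ^ 'n ^ 'm) = 0"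
  by (simp add: vec_eq_iff mat_mul_nth)

lemma mat_scale_mul_left: "mat_scale c A ** B = mat_scale (c :: 'a::field) (A ** B)"
  by (rule mat_eqI) (simp add: mat_mul_nth sum_distrib_left mult.assoc)

lemma mat_scale_mul_right: "A ** mat_scale c B = mat_scale (c :: 'a::field) (A ** B)"
  by (rule mat_eqI) (simp add: mat_mul_nth sum_distrib_left mult.left_commute)

lemma mat_add_mul_left: "(A + B) ** C = A ** C + B ** (C :: 'a::field ^ 'n ^ 'm)"
  by (rule mat_eqI) (simp add: mat_mul_nth distrib_right sum.distrib)

lemma mat_sum_mul_left: "sum f S ** (B :: 'a::field ^ 'n ^ 'm) = (\<Sum>s\<in>S. f s ** B)"
  by (induction S rule: infinite_finite_induct) (simp_all add: mat_add_mul_left)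

lemma mat_sum_mul_right: "(B :: 'a::field ^ 'n ^ 'm) ** sum f S = (\<Sum>s\<in>S. B ** f s)"
  by (induction S rule: infinite_finite_induct) (simp_all add: matrix_add_ldistrib)

lemma mat_scale_uminus: "mat_scale (- c) A = - mat_scale (c :: 'a::field) A"
  by (rule mat_eqI) simp

lemma mat_scale_uminus_right: "mat_scale c (- A) = - mat_scale (c :: 'a::field) A"
  by (rule mat_eqI) simp

lemma mat_mul_uminus_right: "A ** (- B) = - (A ** (B :: 'a::field ^ 'n ^ 'm))"
  by (rule mat_eqI) (simp add: mat_mul_nth sum_negf)

lemma mat_mul_uminus_left: "(- A) ** B = - (A ** (B :: 'a::field ^ 'n ^ 'm))"
  by (rule mat_eqI) (simp add: mat_mul_nth sum_negf)

lemmas mat_scale_simps = mat_scale_mul_left mat_scale_mul_right mat_vs.scale_right_distrib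
  mat_vs.scale_scale mat_vs.scale_sum_right mat_vs.scale_zero_right mat_vs.scale_one
  mat_scale_uminus mat_scale_uminus_right mat_mul_uminus_left mat_mul_uminus_right

subsection \<open>Expansion of the standard polynomial along the first letter\<close>

text \<open>A permutation of \<open>n + 1\<close> positions is recorded by the image
  \<open>i\<close> of 0 and by the permutation of the other \<open>n\<close> values after
  \<open>i\<close> is skipped; this decomposition underlies the expansion by the first
  letter.\<close>

definition insert_perm :: "nat \<Rightarrow> (nat \<Rightarrow> nat) \<Rightarrow> nat \<Rightarrow> nat"
  where "insert_perm i \<tau> j =
    (case j of 0 \<Rightarrow> i | Suc l \<Rightarrow> if \<tau> l < i then \<tau> l else Suc (\<tau> l))"

text \<open>Raising the image of 0 from \<open>i\<close> to \<open>i + 1\<close> exchanges these two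
  values and fixes all others, so the sign can be computed by induction on \<open>i\<close>.\<close>

lemma insert_perm_Suc:
  assumes "\<tau> permutes {..<n}"
  shows "insert_perm (Suc i) \<tau> = Transposition.transpose i (Suc i) \<circ> insert_perm i \<tau>"
  by (rule ext) (auto simp: insert_perm_def Transposition.transpose_def split: nat.splits)

lemma insert_perm_sign:
  assumes "\<tau> permutes {..<n}" "i \<le> n"
  shows "insert_perm i \<tau> permutes {..<Suc n} \<and> sign (insert_perm i \<tau>) = (- 1) ^ i * sign \<tau>"
  using assms(2)
proof (induction i)
  case 0
  have im: "j \<in> Suc ` {..<n} \<longleftrightarrow> 0 < j \<and> j < Suc n" for j
    by (cases j) auto
  \<comment> \<open>With 0 fixed, the permutation is \<open>\<tau>\<close> transported along
    \<open>Suc\<close>, which preserves the sign.\<close>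
  have eq: "insert_perm 0 \<tau> = map_permutation {..<n} Suc \<tau>"
  proof
    fix j
    show "insert_perm 0 \<tau> j = map_permutation {..<n} Suc \<tau> j"
    proof (cases j)
      case (Suc l)
      have "inv_into {..<n} Suc (Suc l) = l" if "l < n"
        using that by (intro inv_into_f_f) auto
      then show ?thesis
        using Suc permutes_not_in[OF assms(1), of l]
        by (auto simp: insert_perm_def map_permutation_def restrict_id_def im)
    qed (auto simp: insert_perm_def map_permutation_def restrict_id_def im)
  qed
  have "map_permutation {..<n} Suc \<tau> permutes Suc ` {..<n}"
    by (rule map_permutation_permutes) (use assms in \<open>auto simp: inj_on_imp_bij_betw\<close>)
  then have "map_permutation {..<n} Suc \<tau> permutes {..<Suc n}"
    by (rule permutes_subset) auto
  moreover have "sign (map_permutation {..<n} Suc \<tau>) = sign \<tau>"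
    by (rule sign_map_permutation) (use assms in auto)
  ultimately show ?case
    by (simp add: eq)
next
  case (Suc i)
  then have IH: "insert_perm i \<tau> permutes {..<Suc n}" "sign (insert_perm i \<tau>) = (- 1) ^ i * sign \<tau>"
    by auto
  have t: "Transposition.transpose i (Suc i) permutes {..<Suc n}"
    using Suc.prems by (intro permutes_swap_id) auto
  have "permutation (insert_perm i \<tau>)" "permutation (Transposition.transpose i (Suc i))"
    using IH(1) t by (auto simp: permutation_permutes)
  then have "sign (insert_perm (Suc i) \<tau>) = (- 1) ^ Suc i * sign \<tau>"
    unfolding insert_perm_Suc[OF assms(1)] by (subst sign_compose) (simp_all add: sign_swap_id IH)
  then show ?case
    using permutes_compose[OF IH(1) t] unfolding insert_perm_Suc[OF assms(1)] by blast
qed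

text \<open>Injectivity is read off from the values; surjectivity follows by counting, since
  \<open>(n + 1) * n! = (n + 1)!\<close>.\<close>

lemma bij_betw_insert_perm:
  "bij_betw (\<lambda>(i, \<tau>). insert_perm i \<tau>) ({..<Suc n} \<times> {\<tau>. \<tau> permutes {..<n}})
    {\<sigma>. \<sigma> permutes {..<Suc n}}"
proof -
  let ?f = "\<lambda>(i, \<tau>). insert_perm i \<tau>" and ?D = "{..<Suc n} \<times> {\<tau>. \<tau> permutes {..<n}}"
  have inj: "inj_on ?f ?D"
  proof (rule inj_onI, clarify)
    fix i \<tau> i' \<tau>'
    assume eq: "insert_perm i \<tau> = insert_perm i' \<tau>'"
    from fun_cong[OF eq, of 0] have i: "i = i'"
      by (simp add: insert_perm_def)
    have "\<tau> l = \<tau>' l" for l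
      using fun_cong[OF eq, of "Suc l"] i by (auto simp: insert_perm_def split: if_splits)
    with i show "i = i' \<and> \<tau> = \<tau>'"
      by auto
  qed
  have "?f ` ?D = {\<sigma>. \<sigma> permutes {..<Suc n}}"
  proof (rule card_subset_eq)
    show "?f ` ?D \<subseteq> {\<sigma>. \<sigma> permutes {..<Suc n}}"
      using insert_perm_sign[of _ n] by (auto simp: less_Suc_eq_le)
    show "card (?f ` ?D) = card {\<sigma>. \<sigma> permutes {..<Suc n}}"
      by (simp add: card_image[OF inj] card_cartesian_product card_permutations)
  qed (simp add: finite_permutations)
  with inj show ?thesis
    by (simp add: bij_betw_def)
qed

lemma stp_Nil [simp]: "stp [] = mat 1"
proof -
  have "{\<sigma>. \<sigma> permutes {..<0::nat}} = {id}"
    by auto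
  then show ?thesis
    by (simp add: standard_polynomial_def mat_prod_list_def)
qed

text \<open>The permutations are grouped by the letter that comes first, as in the Laplace expansion
  of a determinant. Later inductions on the length of a word go through this formula.\<close>

lemma stp_expand:
  assumes "ys \<noteq> []"
  shows "stp ys = (\<Sum>i<length ys. mat_scale ((- 1) ^ i) (ys ! i ** stp (del i ys)))"
proof -
  obtain n where n: "length ys = Suc n"
    using assms by (cases ys) auto
  have map_eq: "map (\<lambda>j. ys ! insert_perm i \<tau> j) [0..<Suc n]
      = ys ! i # map (\<lambda>j. del i ys ! \<tau> j) [0..<n]"
    if "i < Suc n" "\<tau> permutes {..<n}" for i \<tau>
  proof -
    have "del i ys ! \<tau> j = ys ! (if \<tau> j < i then \<tau> j else Suc (\<tau> j))" if "j < n" for j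
    proof -
      have "\<tau> j < n"
        using permutes_in_image[OF \<open>\<tau> permutes {..<n}\<close>, of j] that by auto
      then show ?thesis
        using n \<open>i < Suc n\<close> by (auto simp: nth_append min_def)
    qed
    then show ?thesis
      by (subst upt_conv_Cons) (auto simp: insert_perm_def map_Suc_upt[symmetric] simp del: upt_Suc)
  qed
  have len: "length (del i ys) = n" if "i < Suc n" for i
    using n that by auto
  have "stp ys = (\<Sum>(i, \<tau>)\<in>{..<Suc n} \<times> {\<tau>. \<tau> permutes {..<n}}.
      mat_scale (of_int (sign (insert_perm i \<tau>)))
        (mat_prod_list (map (\<lambda>j. ys ! insert_perm i \<tau> j) [0..<Suc n])))"
    unfolding standard_polynomial_def n
    by (subst sum.reindex_bij_betw[OF bij_betw_insert_perm, symmetric]) (simp add: case_prod_unfold)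
  also have "\<dots> = (\<Sum>(i, \<tau>)\<in>{..<Suc n} \<times> {\<tau>. \<tau> permutes {..<n}}.
      mat_scale ((- 1) ^ i) (ys ! i **
        mat_scale (of_int (sign \<tau>)) (mat_prod_list (map (\<lambda>j. del i ys ! \<tau> j) [0..<n]))))"
    by (rule sum.cong)
      (auto simp: insert_perm_sign map_eq mat_prod_list_def mat_scale_simps simp del: upt_Suc)
  also have "\<dots> = (\<Sum>i<Suc n. mat_scale ((- 1) ^ i) (ys ! i ** stp (del i ys)))"
    unfolding sum.cartesian_product[symmetric]
    by (rule sum.cong)
      (use n in \<open>auto simp: standard_polynomial_def mat_scale_simps mat_sum_mul_right min_def\<close>)
  finally show ?thesis
    by (simp add: n)
qed

subsection \<open>Alternating multilinearity\<close>

lemma sum_lessThan_add: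
  "(\<Sum>i<m + n. f i) = (\<Sum>i<m. f i) + (\<Sum>i<n. f (m + i :: nat))"
  by (induction n) (simp_all add: add.assoc)

lemma stp_append_expand:
  assumes "ys \<noteq> []"
  shows "stp (xs @ ys) =
    (\<Sum>i<length xs. mat_scale ((- 1) ^ i) (xs ! i ** stp (del i xs @ ys))) +
    mat_scale ((- 1) ^ length xs)
      (\<Sum>j<length ys. mat_scale ((- 1) ^ j) (ys ! j ** stp (xs @ del j ys)))"
proof -
  have "(\<Sum>i<length xs. mat_scale ((- 1) ^ i) ((xs @ ys) ! i ** stp (del i (xs @ ys))))
      = (\<Sum>i<length xs. mat_scale ((- 1) ^ i) (xs ! i ** stp (del i xs @ ys)))"
    by (rule sum.cong) (auto simp: nth_append)
  moreover have "(\<Sum>j<length ys. mat_scale ((- 1) ^ (length xs + j))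
        ((xs @ ys) ! (length xs + j) ** stp (del (length xs + j) (xs @ ys))))
      = mat_scale ((- 1) ^ length xs)
          (\<Sum>j<length ys. mat_scale ((- 1) ^ j) (ys ! j ** stp (xs @ del j ys)))"
    unfolding mat_vs.scale_sum_right
    by (rule sum.cong) (auto simp: nth_append mat_vs.scale_scale power_add)
  ultimately show ?thesis
    using assms by (subst stp_expand) (simp_all add: sum_lessThan_add del: take_append drop_append)
qed

lemma stp_Cons_expand:
  "stp (y # ys) = y ** stp ys -
    (\<Sum>j<length ys. mat_scale ((- 1) ^ j) (ys ! j ** stp (y # del j ys)))"
proof (cases ys)
  case (Cons z zs)
  then show ?thesis
    using stp_append_expand[of ys "[y]"] by (simp add: mat_scale_uminus)
qed (simp add: stp_expand)

lemma stp_append2_expand: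
  "stp (xs @ a # b # ys) =
    (\<Sum>i<length xs. mat_scale ((- 1) ^ i) (xs ! i ** stp (del i xs @ a # b # ys))) +
    mat_scale ((- 1) ^ length xs) (a ** stp (xs @ b # ys) - b ** stp (xs @ a # ys)
      + (\<Sum>j<length ys. mat_scale ((- 1) ^ j) (ys ! j ** stp (xs @ a # b # del j ys))))"
  using stp_append_expand[of "a # b # ys" xs]
  by (simp add: sum.lessThan_Suc_shift mat_scale_uminus del: sum.lessThan_Suc)

text \<open>The two terms that begin with a copy of \<open>a\<close> cancel; all other terms still
  contain the adjacent pair and vanish by induction.\<close>

lemma stp_adjacent_eq: "stp (xs @ a # a # ys) = 0"
proof (induction "length xs + length ys" arbitrary: xs ys rule: less_induct)
  case less
  have 1: "stp (del i xs @ a # a # ys) = 0" if "i < length xs" for i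
    using that by (intro less) auto
  have 2: "stp (xs @ a # a # del j ys) = 0" if "j < length ys" for j
    using that by (intro less) auto
  show ?case
    using 1 2 by (subst stp_append2_expand) simp
qed

text \<open>The term that begins with the varying letter is linear for a direct reason, the others
  by induction. Treating sums and scalars together keeps this to a single induction.\<close>

lemma stp_linear:
  "stp (xs @ (mat_scale c a + b) # ys) = mat_scale c (stp (xs @ a # ys)) + stp (xs @ b # ys)"
proof (induction "length xs + length ys" arbitrary: xs ys rule: less_induct)
  case less
  have 1: "stp (del i xs @ (mat_scale c a + b) # ys)
      = mat_scale c (stp (del i xs @ a # ys)) + stp (del i xs @ b # ys)" if "i < length xs" for i
    using that by (intro less) auto
  have 2: "stp (xs @ (mat_scale c a + b) # del j ys)
      = mat_scale c (stp (xs @ a # del j ys)) + stp (xs @ b # del j ys)" if "j < length ys" for j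
    using that by (intro less) auto
  have e: "stp (xs @ z # ys) =
    (\<Sum>i<length xs. mat_scale ((- 1) ^ i) (xs ! i ** stp (del i xs @ z # ys))) +
    mat_scale ((- 1) ^ length xs) (z ** stp (xs @ ys)
      - (\<Sum>j<length ys. mat_scale ((- 1) ^ j) (ys ! j ** stp (xs @ z # del j ys))))" for z
    using stp_append_expand[of "z # ys" xs]
    by (simp add: sum.lessThan_Suc_shift mat_scale_uminus sum_negf del: sum.lessThan_Suc)
  have s1: "(\<Sum>i<length xs. mat_scale ((- 1) ^ i) (xs ! i ** stp (del i xs @ (mat_scale c a + b) # ys)))
     = mat_scale c (\<Sum>i<length xs. mat_scale ((- 1) ^ i) (xs ! i ** stp (del i xs @ a # ys)))
     + (\<Sum>i<length xs. mat_scale ((- 1) ^ i) (xs ! i ** stp (del i xs @ b # ys)))"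
    unfolding mat_vs.scale_sum_right sum.distrib[symmetric]
    by (rule sum.cong[OF refl], subst 1)
      (simp_all add: matrix_add_ldistrib mat_scale_simps mult.commute)
  have s2: "(\<Sum>j<length ys. mat_scale ((- 1) ^ j) (ys ! j ** stp (xs @ (mat_scale c a + b) # del j ys)))
     = mat_scale c (\<Sum>j<length ys. mat_scale ((- 1) ^ j) (ys ! j ** stp (xs @ a # del j ys)))
     + (\<Sum>j<length ys. mat_scale ((- 1) ^ j) (ys ! j ** stp (xs @ b # del j ys)))"
    unfolding mat_vs.scale_sum_right sum.distrib[symmetric]
    by (rule sum.cong[OF refl], subst 2)
      (simp_all add: matrix_add_ldistrib mat_scale_simps mult.commute)
  show ?case
    unfolding e s1 s2
    by (rule mat_eqI) (simp add: mat_add_mul_left mat_scale_simps algebra_simps)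
qed

lemma stp_add: "stp (xs @ (a + b) # ys) = stp (xs @ a # ys) + stp (xs @ b # ys)"
  using stp_linear[of xs 1 a b ys] by simp

lemma stp_zero: "stp (xs @ 0 # ys) = 0"
  using stp_linear[of xs 1 0 0 ys] by simp

text \<open>Polarisation of the vanishing on two equal neighbours.\<close>

lemma stp_swap: "stp (xs @ a # b # ys) = - stp (xs @ b # a # ys)"
proof -
  have "0 = stp (xs @ (a + b) # (a + b) # ys)"
    by (simp add: stp_adjacent_eq)
  also have "\<dots> = stp (xs @ a # a # ys) + stp (xs @ a # b # ys)
      + (stp (xs @ b # a # ys) + stp (xs @ b # b # ys))"
    using stp_add[of "xs @ [a]" a b ys] stp_add[of "xs @ [b]" a b ys]
    by (simp add: stp_add)
  finally show ?thesis
    by (simp add: stp_adjacent_eq eq_neg_iff_add_eq_0)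
qed

lemma stp_move: "stp (P @ xs @ y # zs) = mat_scale ((- 1) ^ length xs) (stp (P @ y # xs @ zs))"
proof (induction xs arbitrary: P)
  case (Cons x xs)
  have "stp (P @ (x # xs) @ y # zs) = stp ((P @ [x]) @ xs @ y # zs)"
    by simp
  also have "\<dots> = mat_scale ((- 1) ^ length xs) (stp (P @ x # y # xs @ zs))"
    by (subst Cons.IH) simp
  also have "\<dots> = mat_scale ((- 1) ^ length (x # xs)) (stp (P @ y # (x # xs) @ zs))"
    by (subst stp_swap) (simp add: mat_scale_uminus mat_scale_uminus_right)
  finally show ?case .
qed simp

text \<open>Reordering costs only a sign. Which sign is left open, since the statement serves only
  to show that words vanish or do not vanish.\<close>

lemma stp_mset_eq:
  assumes "mset xs = mset ys"
  shows "stp xs = stp ys \<or> stp xs = - stp ys"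
proof -
  have "stp (P @ xs) = stp (P @ ys) \<or> stp (P @ xs) = - stp (P @ ys)" for P
    using assms
  proof (induction xs arbitrary: P ys)
    case (Cons x xs)
    then have "x \<in> set ys"
      by (metis list.set_intros(1) mset_eq_setD)
    then obtain ys1 ys2 where ys: "ys = ys1 @ x # ys2"
      by (metis split_list)
    with Cons.prems have "mset xs = mset (ys1 @ ys2)"
      by simp
    from Cons.IH[OF this, of "P @ [x]"]
    have "stp (P @ x # xs) = stp (P @ x # ys1 @ ys2) \<or> stp (P @ x # xs) = - stp (P @ x # ys1 @ ys2)"
      by simp
    moreover have "stp (P @ ys) = stp (P @ x # ys1 @ ys2) \<or> stp (P @ ys) = - stp (P @ x # ys1 @ ys2)"
      unfolding ys stp_move by (cases "even (length ys1)") (simp_all add: mat_scale_uminus)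
    ultimately show ?case
      by auto
  qed simp
  from this[of "[]"] show ?thesis
    by simp
qed

lemma stp_not_distinct:
  assumes "\<not> distinct ys"
  shows "stp ys = 0"
proof -
  obtain xs a zs us where "ys = xs @ [a] @ zs @ [a] @ us"
    using not_distinct_decomp[OF assms] by blast
  then have "mset ys = mset (a # a # xs @ zs @ us)"
    by simp
  from stp_mset_eq[OF this] show ?thesis
    using stp_adjacent_eq[of "[]" a] by auto
qed

subsection \<open>Letters that are forced to be first or last\<close>

text \<open>Left multiplication by \<open>e\<close> kills every term whose first letter is not
  \<open>a\<close>.\<close>

lemma stp_first:
  assumes "\<And>y. y \<in> set ys \<Longrightarrow> e ** y = 0"
  shows "e ** stp (a # ys) = e ** a ** stp ys"
proof -
  have "e ** (\<Sum>j<length ys. mat_scale ((- 1) ^ j) (ys ! j ** stp (a # del j ys))) = 0"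
    using assms by (simp add: mat_sum_mul_right mat_scale_simps matrix_mul_assoc)
  then have "e ** (a ** stp ys - (\<Sum>j<length ys. mat_scale ((- 1) ^ j) (ys ! j ** stp (a # del j ys))))
      = e ** a ** stp ys"
    unfolding diff_conv_add_uminus matrix_add_ldistrib mat_mul_uminus_right
    by (simp add: matrix_mul_assoc)
  then show ?thesis
    by (subst stp_Cons_expand)
qed

text \<open>Inside a product \<open>a\<close> would be preceded by some letter of \<open>ys\<close>,
  and the product would vanish; so \<open>a\<close> comes first in every surviving word.\<close>

lemma stp_source:
  assumes "\<And>y. y \<in> set ys \<Longrightarrow> y ** a = 0"
  shows "stp (a # ys) = a ** stp ys"
  using assms
proof (induction "length ys" arbitrary: ys rule: less_induct)
  case less
  have "stp (a # del j ys) = a ** stp (del j ys)" if "j < length ys" for j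
    by (rule less) (use that less.prems in \<open>auto dest: in_set_takeD in_set_dropD\<close>)
  then have "(\<Sum>j<length ys. mat_scale ((- 1) ^ j) (ys ! j ** stp (a # del j ys))) = 0"
    using less.prems by (intro sum.neutral) (auto simp: matrix_mul_assoc)
  then show ?case
    by (subst stp_Cons_expand) simp
qed

text \<open>The mirror image of \<open>stp_source\<close>: no letter may follow \<open>a\<close>, so
  \<open>a\<close> comes last, which is already its place in the list and brings no sign.\<close>

lemma stp_sink:
  assumes "\<And>y. y \<in> set ys \<Longrightarrow> a ** y = 0"
  shows "stp (ys @ [a]) = stp ys ** a"
  using assms
proof (induction "length ys" arbitrary: ys rule: less_induct)
  case less
  show ?case
  proof (cases "ys = []")
    case True
    then show ?thesis
      by (simp add: stp_expand)
  next
    case False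
    have "stp (del j ys @ [a]) = stp (del j ys) ** a" if "j < length ys" for j
      by (rule less(1)) (use that less.prems in \<open>auto dest: in_set_takeD in_set_dropD\<close>)
    then have *: "(\<Sum>i<length ys. mat_scale ((- 1) ^ i) (ys ! i ** stp (del i ys @ [a])))
        = stp ys ** a"
      unfolding stp_expand[OF False] mat_sum_mul_left
      by (intro sum.cong) (simp_all add: mat_scale_simps matrix_mul_assoc)
    have "a ** stp ys = 0"
      using less.prems unfolding stp_expand[OF False]
      by (simp add: mat_sum_mul_right mat_scale_simps matrix_mul_assoc)
    with * show ?thesis
      using stp_append_expand[of "[a]" ys] by simp
  qed
qed

subsection \<open>Gradings\<close>

text \<open>The grading of the matrix algebra in which position \<open>(p, q)\<close> has degree
  \<open>\<phi> q - \<phi> p\<close> modulo \<open>m\<close>. Modulus 0 gives a grading by integers;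
  modulus 2 and modulus \<open>card I\<close> also occur.\<close>

definition homogeneous :: "('n \<Rightarrow> int) \<Rightarrow> int \<Rightarrow> int \<Rightarrow> ('a::zero ^ 'n ^ 'n) \<Rightarrow> bool"
  where "homogeneous \<phi> m w A \<longleftrightarrow> (\<forall>p q. A $ p $ q \<noteq> 0 \<longrightarrow> m dvd \<phi> q - \<phi> p - w)"

lemma homogeneousD: "homogeneous \<phi> m w A \<Longrightarrow> A $ p $ q \<noteq> 0 \<Longrightarrow> m dvd \<phi> q - \<phi> p - w"
  by (auto simp: homogeneous_def)

lemma homogeneous_mult:
  assumes "homogeneous \<phi> m v A" "homogeneous \<phi> m w (B :: 'a::field ^ 'n::finite ^ 'n)"
  shows "homogeneous \<phi> m (v + w) (A ** B)"
  unfolding homogeneous_def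
proof (intro allI impI)
  fix p q
  assume "(A ** B) $ p $ q \<noteq> 0"
  then obtain k where "A $ p $ k * B $ k $ q \<noteq> 0"
    unfolding mat_mul_nth by (meson sum.neutral)
  then have "m dvd \<phi> k - \<phi> p - v" "m dvd \<phi> q - \<phi> k - w"
    using assms by (auto dest: homogeneousD)
  then have "m dvd (\<phi> k - \<phi> p - v) + (\<phi> q - \<phi> k - w)"
    by (rule dvd_add)
  then show "m dvd \<phi> q - \<phi> p - (v + w)"
    by (simp add: algebra_simps)
qed

text \<open>Degrees add under multiplication. Letters are paired with their degrees because a matrix
  such as 0 is homogeneous of every degree, and because deleting a letter must delete its degree
  too.\<close>

lemma homogeneous_stp:
  assumes "\<And>y w. (y, w) \<in> set zs \<Longrightarrow> homogeneous \<phi> m w (y :: 'a::field ^ 'n::finite ^ 'n)"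
  shows "homogeneous \<phi> m (sum_list (map snd zs)) (stp (map fst zs))"
  using assms
proof (induction "length zs" arbitrary: zs rule: less_induct)
  case less
  show ?case
  proof (cases "zs = []")
    case True
    then show ?thesis
      by (simp add: homogeneous_def mat_def)
  next
    case False
    then have map_fst_nonempty: "map fst zs \<noteq> []"
      by simp
    show ?thesis
      unfolding homogeneous_def
    proof (intro allI impI)
      fix p q
      assume "stp (map fst zs) $ p $ q \<noteq> 0"
      then obtain i where i: "i < length zs"
        "(mat_scale ((- 1) ^ i) (map fst zs ! i ** stp (del i (map fst zs)))) $ p $ q \<noteq> 0"
        using False unfolding stp_expand[OF map_fst_nonempty] sum_component
        by (metis (no_types, lifting) length_map lessThan_iff sum.neutral)
      have "homogeneous \<phi> m (sum_list (map snd (del i zs))) (stp (map fst (del i zs)))"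
        by (rule less(1)) (use i less.prems in \<open>auto dest: in_set_takeD in_set_dropD\<close>)
      moreover have "homogeneous \<phi> m (snd (zs ! i)) (fst (zs ! i))"
        using less.prems[of "fst (zs ! i)" "snd (zs ! i)"] i by auto
      ultimately have "homogeneous \<phi> m (snd (zs ! i) + sum_list (map snd (del i zs)))
          (fst (zs ! i) ** stp (map fst (del i zs)))"
        by (intro homogeneous_mult)
      moreover have "snd (zs ! i) + sum_list (map snd (del i zs)) = sum_list (map snd zs)"
        using i by (subst (3) id_take_nth_drop[of i zs]) simp_all
      moreover have "(fst (zs ! i) ** stp (map fst (del i zs))) $ p $ q \<noteq> 0"
        using i by (simp add: take_map drop_map)
      ultimately show "m dvd \<phi> q - \<phi> p - sum_list (map snd zs)"
        by (metis homogeneousD)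
    qed
  qed
qed

subsection \<open>Matrix units\<close>

definition munit :: "'n \<Rightarrow> 'm \<Rightarrow> 'a::zero_neq_one ^ 'm ^ 'n"
  where "munit a b = (\<chi> i j. if i = a \<and> j = b then 1 else 0)"

lemma munit_nth: "munit a b $ i $ j = (if i = a \<and> j = b then 1 else 0)"
  by (simp add: munit_def)

lemma munit_mul_nth:
  "(munit a b ** (A :: 'a::field ^ 'n ^ 'm)) $ i $ j = (if i = a then A $ b $ j else 0)"
  by (simp add: mat_mul_nth munit_nth if_distrib[of "\<lambda>c. c * _"] cong: if_cong)

lemma mul_munit_nth:
  "((A :: 'a::field ^ 'n ^ 'm) ** munit a b) $ i $ j = (if j = b then A $ i $ a else 0)"
  by (simp add: mat_mul_nth munit_nth if_distrib[of "\<lambda>c. _ * c"] cong: if_cong)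

lemma munit_mul_munit:
  "munit a b ** (munit c d :: 'a::field ^ 'n ^ 'm) = (if b = c then munit a d else 0)"
  by (rule mat_eqI) (simp add: munit_mul_nth munit_nth)

lemma inj_munit: "inj (\<lambda>e. munit (fst e) (snd e) :: 'a::zero_neq_one ^ 'n ^ 'm)"
proof (rule injI)
  fix e f :: "'m \<times> 'n"
  assume "(munit (fst e) (snd e) :: 'a ^ 'n ^ 'm) = munit (fst f) (snd f)"
  then have "(munit (fst e) (snd e) :: 'a ^ 'n ^ 'm) $ fst e $ snd e = munit (fst f) (snd f) $ fst e $ snd e"
    by simp
  then show "e = f"
    by (auto simp: munit_nth prod_eq_iff split: if_splits)
qed

lemma mul_munit_eq_0:
  "(A :: 'a::field ^ 'n ^ 'm) ** munit a b = 0 \<longleftrightarrow> (\<forall>k. A $ k $ a = 0)"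
  by (auto simp: vec_eq_iff mul_munit_nth)

lemma mat_eq_sum_munit:
  "A = (\<Sum>a\<in>UNIV. \<Sum>b\<in>UNIV. mat_scale (A $ a $ b) (munit a b :: 'a::field ^ 'n ^ 'm))"
proof (rule mat_eqI)
  fix i j
  have "(\<Sum>b\<in>UNIV. A $ a $ b * munit a b $ i $ j) = (if i = a then A $ a $ j else 0)" for a
    by (simp add: munit_nth if_distrib[of "\<lambda>c. _ * c"] cong: if_cong)
  then show "A $ i $ j =
      (\<Sum>a\<in>UNIV. \<Sum>b\<in>UNIV. mat_scale (A $ a $ b) (munit a b :: 'a ^ 'n ^ 'm)) $ i $ j"
    by (simp add: sum_component)
qed

text \<open>
  The only way through a vertex \<open>x\<close> met by no other letter is \<open>u x, x x, x w\<close>, unless the word starts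
  at \<open>x\<close>; this is why row \<open>x\<close> is excluded.
\<close>

lemma stp_contract:
  fixes P R :: "('a::field ^ 'n::finite ^ 'n) list"
  assumes "\<And>y k. y \<in> set P \<union> set R \<Longrightarrow> y $ k $ x = 0" "u \<noteq> x" "w \<noteq> x" "i \<noteq> x"
  shows "stp (P @ munit u x # munit x x # munit x w # R) $ i $ j = stp (P @ munit u w # R) $ i $ j"
  using assms(1,4)
proof (induction "length P + length R" arbitrary: P R i rule: less_induct)
  case less
  let ?a = "munit u x :: 'a ^ 'n ^ 'n" and ?b = "munit x x :: 'a ^ 'n ^ 'n"
    and ?c = "munit x w :: 'a ^ 'n ^ 'n" and ?d = "munit u w :: 'a ^ 'n ^ 'n"
  \<comment> \<open>Agreement of \<open>M\<close> and \<open>N\<close> outside row \<open>x\<close>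
    is enough, because \<open>y\<close> has no entry in column \<open>x\<close>; so the induction
    hypothesis is needed only for rows other than \<open>x\<close>.\<close>
  have row: "(y ** M) $ i $ j = (y ** N) $ i $ j"
    if "y \<in> set P \<union> set R" "\<And>k. k \<noteq> x \<Longrightarrow> M $ k $ j = N $ k $ j" for y M N
    unfolding mat_mul_nth
    by (rule sum.cong) (use less.prems(1)[OF that(1)] that(2) in \<open>force+\<close>)
  have P: "(P ! l ** stp (del l P @ ?a # ?b # ?c # R)) $ i $ j = (P ! l ** stp (del l P @ ?d # R)) $ i $ j"
    if "l < length P" for l
  proof (rule row)
    show "stp (del l P @ ?a # ?b # ?c # R) $ k $ j = stp (del l P @ ?d # R) $ k $ j" if "k \<noteq> x" for k
      by (rule less(1))
        (use that \<open>l < length P\<close> less.prems in \<open>auto dest: in_set_takeD in_set_dropD\<close>)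
  qed (use that in auto)
  have R: "(R ! l ** stp (P @ ?a # ?b # ?c # del l R)) $ i $ j = (R ! l ** stp (P @ ?d # del l R)) $ i $ j"
    if "l < length R" for l
  proof (rule row)
    show "stp (P @ ?a # ?b # ?c # del l R) $ k $ j = stp (P @ ?d # del l R) $ k $ j" if "k \<noteq> x" for k
      by (rule less(1))
        (use that \<open>l < length R\<close> less.prems in \<open>auto dest: in_set_takeD in_set_dropD\<close>)
  qed (use that in auto)
  \<comment> \<open>\<open>?b\<close> and \<open>?c\<close> each pass the whole of \<open>P\<close>,
    so the two signs cancel. No letter of \<open>P\<close> or \<open>R\<close> leads to
    \<open>x\<close>, hence these two come first, in this order.\<close>
  have "stp (P @ ?b # ?c # R) = stp (?b # ?c # P @ R)"
    using stp_move[of "[]" P ?b "?c # R"] stp_move[of "[?b]" P ?c R]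
    by (simp add: mat_vs.scale_scale flip: power_add mult_2)
  also have "\<dots> = ?b ** stp (?c # P @ R)"
    by (rule stp_source) (use less.prems assms in \<open>auto simp: mul_munit_eq_0 munit_nth\<close>)
  also have "stp (?c # P @ R) = ?c ** stp (P @ R)"
    by (rule stp_source) (use less.prems in \<open>auto simp: mul_munit_eq_0\<close>)
  finally have a: "(?a ** stp (P @ ?b # ?c # R)) $ i $ j = (?d ** stp (P @ R)) $ i $ j"
    by (simp add: matrix_mul_assoc munit_mul_munit)
  \<comment> \<open>The words that begin with \<open>?b\<close> or \<open>?c\<close> live in row
    \<open>x\<close> and drop out, as \<open>i \<noteq> x\<close>.\<close>
  have "stp (P @ ?a # ?b # ?c # R) $ i $ j =
      (\<Sum>l<length P. (- 1) ^ l * (P ! l ** stp (del l P @ ?a # ?b # ?c # R)) $ i $ j) +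
      (- 1) ^ length P * ((?a ** stp (P @ ?b # ?c # R)) $ i $ j
        - (\<Sum>l<length R. (- 1) ^ l * (R ! l ** stp (P @ ?a # ?b # ?c # del l R)) $ i $ j))"
    using less.prems(2)
    by (subst stp_append_expand)
      (simp_all add: sum.lessThan_Suc_shift sum_component munit_mul_nth sum_negf
        del: sum.lessThan_Suc)
  also have "\<dots> = (\<Sum>l<length P. (- 1) ^ l * (P ! l ** stp (del l P @ ?d # R)) $ i $ j) +
      (- 1) ^ length P * ((?d ** stp (P @ R)) $ i $ j
        - (\<Sum>l<length R. (- 1) ^ l * (R ! l ** stp (P @ ?d # del l R)) $ i $ j))"
    using P R a by simp
  also have "\<dots> = stp (P @ ?d # R) $ i $ j"
    by (subst stp_append_expand)
      (simp_all add: sum.lessThan_Suc_shift sum_component sum_negf del: sum.lessThan_Suc)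
  finally show ?case .
qed

text \<open>Every inner vertex of the walk carries a loop, the configuration that
  \<open>stp_contract\<close> removes.\<close>

fun path_word :: "'n \<Rightarrow> 'n list \<Rightarrow> 'n \<Rightarrow> ('a::field ^ 'n ^ 'n) list"
  where
    "path_word u [] w = [munit u w]"
  | "path_word u (x # xs) w = munit u x # munit x x # path_word x xs w"

lemma stp_contract_path:
  fixes P R :: "('a::field ^ 'n::finite ^ 'n) list"
  assumes "\<And>y k x. y \<in> set P \<union> set R \<Longrightarrow> x \<in> set xs \<Longrightarrow> y $ k $ x = 0"
    and "distinct (u # xs)" "w \<notin> set xs" "i \<notin> set xs"
  shows "stp (P @ path_word u xs w @ R) $ i $ j = stp (P @ munit u w # R) $ i $ j"
  using assms
proof (induction xs arbitrary: u P)
  case (Cons x xs)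
  \<comment> \<open>The rest of the path is contracted first, with the edge into \<open>x\<close>
    and the loop at \<open>x\<close> in the prefix; the vertex \<open>x\<close> goes last.\<close>
  have "stp ((P @ [munit u x, munit x x]) @ path_word x xs w @ R) $ i $ j
      = stp ((P @ [munit u x, munit x x]) @ munit x w # R) $ i $ j"
    by (rule Cons.IH) (use Cons.prems in \<open>auto simp: munit_nth\<close>)
  moreover have "stp (P @ munit u x # munit x x # munit x w # R) $ i $ j = stp (P @ munit u w # R) $ i $ j"
    by (rule stp_contract) (use Cons.prems in auto)
  ultimately show ?case
    by simp
qed simp

section \<open>Explicit evaluation of short words of matrix units\<close>

lemma stp_Cons_nth:
  "stp (y # ys) $ i $ j =
    (\<Sum>l<Suc (length ys). (- 1) ^ l * ((y # ys) ! l ** stp (del l (y # ys))) $ i $ j)"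
  by (subst stp_expand) (simp_all add: sum_component)

text \<open>The entry counts, with sign, the Eulerian trails from \<open>p\<close> to
  \<open>q\<close> of a triangle with an extra edge from \<open>p\<close> to \<open>q\<close> and a
  loop at \<open>q\<close>. There are four: three of sign 1 and one of sign -1.\<close>

lemma stp_offdiag_word:
  assumes "distinct [p, u, q]"
  shows "stp [munit p u, munit u q, munit q p, munit p q, munit q q] $ p $ q = (2 :: 'a::field)"
proof -
  have "p \<noteq> u" "u \<noteq> p" "p \<noteq> q" "q \<noteq> p" "u \<noteq> q" "q \<noteq> u"
    using assms by auto
  then show ?thesis
    by (simp add: stp_Cons_nth munit_mul_nth munit_nth numeral_nat mat_def)
qed

text \<open>Signed counts of closed Eulerian trails on a triangle with a loop at \<open>z\<close>
  and one at \<open>x\<close> or \<open>y\<close>. As a 2 by 2 matrix these four numbers have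
  determinant -2.\<close>

lemma stp_diag_word1:
  assumes "distinct [x, y, z]"
  shows "stp [munit x y, munit y z, munit z x, munit x x, munit z z] $ x $ x = (2 :: 'a::field)"
    "stp [munit x y, munit y z, munit z x, munit x x, munit z z] $ z $ z = (2 :: 'a::field)"
    "stp [munit x y, munit y z, munit z x, munit y y, munit z z] $ x $ x = (- 1 :: 'a::field)"
    "stp [munit x y, munit y z, munit z x, munit y y, munit z z] $ z $ z = (- 2 :: 'a::field)"
proof -
  have "x \<noteq> y" "y \<noteq> x" "x \<noteq> z" "z \<noteq> x" "y \<noteq> z" "z \<noteq> y"
    using assms by auto
  note simps = this stp_Cons_nth munit_mul_nth munit_nth numeral_nat mat_def
  show "stp [munit x y, munit y z, munit z x, munit x x, munit z z] $ x $ x = (2 :: 'a::field)"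
    by (simp add: simps)
  show "stp [munit x y, munit y z, munit z x, munit x x, munit z z] $ z $ z = (2 :: 'a::field)"
    by (simp add: simps)
  show "stp [munit x y, munit y z, munit z x, munit y y, munit z z] $ x $ x = (- 1 :: 'a::field)"
    by (simp add: simps)
  show "stp [munit x y, munit y z, munit z x, munit y y, munit z z] $ z $ z = (- 2 :: 'a::field)"
    by (simp add: simps)
qed

text \<open>The case of two vertices, with determinant -3; this is where characteristic 3 must be
  excluded for \<open>r = 1\<close>.\<close>

lemma stp_diag_word2:
  assumes "x \<noteq> y"
  shows "stp [munit x y, munit y x, munit x x] $ x $ x = (2 :: 'a::field)"
    "stp [munit x y, munit y x, munit x x] $ y $ y = (1 :: 'a::field)"
    "stp [munit x y, munit y x, munit y y] $ x $ x = (- 1 :: 'a::field)"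
    "stp [munit x y, munit y x, munit y y] $ y $ y = (- 2 :: 'a::field)"
proof -
  have "x \<noteq> y" "y \<noteq> x"
    using assms by auto
  note simps = this stp_Cons_nth munit_mul_nth munit_nth numeral_nat mat_def
  show "stp [munit x y, munit y x, munit x x] $ x $ x = (2 :: 'a::field)"
    by (simp add: simps)
  show "stp [munit x y, munit y x, munit x x] $ y $ y = (1 :: 'a::field)"
    by (simp add: simps)
  show "stp [munit x y, munit y x, munit y y] $ x $ x = (- 1 :: 'a::field)"
    by (simp add: simps)
  show "stp [munit x y, munit y x, munit y y] $ y $ y = (- 2 :: 'a::field)"
    by (simp add: simps)
qed

subsection \<open>Genericity\<close>

text \<open>Covers two cases at once: polynomial functions on tuples of matrices and polynomial
  functions of one parameter.\<close>

definition fun_ring :: "('p \<Rightarrow> 'a::comm_ring_1) set \<Rightarrow> bool"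
  where "fun_ring R \<longleftrightarrow> (\<forall>c. (\<lambda>_. c) \<in> R) \<and>
    (\<forall>f\<in>R. \<forall>g\<in>R. (\<lambda>x. f x + g x) \<in> R \<and> (\<lambda>x. f x * g x) \<in> R)"

lemma fun_ring_const: "fun_ring R \<Longrightarrow> (\<lambda>_. c) \<in> R"
  by (simp add: fun_ring_def)

lemma fun_ring_add: "fun_ring R \<Longrightarrow> f \<in> R \<Longrightarrow> g \<in> R \<Longrightarrow> (\<lambda>x. f x + g x) \<in> R"
  by (simp add: fun_ring_def)

lemma fun_ring_mult: "fun_ring R \<Longrightarrow> f \<in> R \<Longrightarrow> g \<in> R \<Longrightarrow> (\<lambda>x. f x * g x) \<in> R"
  by (simp add: fun_ring_def)

lemma fun_ring_diff:
  assumes "fun_ring R" "f \<in> R" "g \<in> R"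
  shows "(\<lambda>x. f x - g x) \<in> R"
  using fun_ring_add[OF assms(1,2) fun_ring_mult[OF assms(1) fun_ring_const[of R "- 1"] assms(3)]] assms(1)
  by simp

lemma fun_ring_sum:
  assumes "fun_ring R" "\<And>i. i \<in> I \<Longrightarrow> f i \<in> R"
  shows "(\<lambda>x. \<Sum>i\<in>I. f i x) \<in> R"
  using assms(2)
  by (induction I rule: infinite_finite_induct)
    (simp_all add: fun_ring_const[OF assms(1)] fun_ring_add[OF assms(1)])

lemma fun_ring_prod:
  assumes "fun_ring R" "\<And>i. i \<in> I \<Longrightarrow> f i \<in> R"
  shows "(\<lambda>x. \<Prod>i\<in>I. f i x) \<in> R"
  using assms(2)
  by (induction I rule: infinite_finite_induct)
    (simp_all add: fun_ring_const[OF assms(1)] fun_ring_mult[OF assms(1)])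

definition mat_fun :: "('p \<Rightarrow> 'a) set \<Rightarrow> ('p \<Rightarrow> 'a ^ 'n ^ 'm) \<Rightarrow> bool"
  where "mat_fun R F \<longleftrightarrow> (\<forall>i j. (\<lambda>x. F x $ i $ j) \<in> R)"

lemma mat_funD: "mat_fun R F \<Longrightarrow> (\<lambda>x. F x $ i $ j) \<in> R"
  by (simp add: mat_fun_def)

lemma mat_fun_const: "fun_ring R \<Longrightarrow> mat_fun R (\<lambda>_. A)"
  by (simp add: mat_fun_def fun_ring_const)

lemma mat_fun_add: "fun_ring R \<Longrightarrow> mat_fun R F \<Longrightarrow> mat_fun R G \<Longrightarrow> mat_fun R (\<lambda>x. F x + G x)"
  by (simp add: mat_fun_def fun_ring_add)

lemma mat_fun_scale: "fun_ring R \<Longrightarrow> f \<in> R \<Longrightarrow> mat_fun R F \<Longrightarrow> mat_fun R (\<lambda>x. mat_scale (f x) (F x))"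
  by (simp add: mat_fun_def mat_scale_def fun_ring_mult)

lemma mat_fun_mult: "fun_ring R \<Longrightarrow> mat_fun R F \<Longrightarrow> mat_fun R G \<Longrightarrow> mat_fun R (\<lambda>x. F x ** G x)"
  by (simp add: mat_fun_def matrix_matrix_mult_def fun_ring_sum fun_ring_mult)

lemma mat_fun_sum:
  assumes "fun_ring R" "\<And>i. i \<in> I \<Longrightarrow> mat_fun R (F i)"
  shows "mat_fun R (\<lambda>x. \<Sum>i\<in>I. F i x)"
  using assms by (simp add: mat_fun_def sum_component fun_ring_sum)

lemma mat_fun_stp:
  assumes "fun_ring R" "\<And>F. F \<in> set Fs \<Longrightarrow> mat_fun R F"
  shows "mat_fun R (\<lambda>x. stp (map (\<lambda>F. F x) Fs))"
  using assms(2)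
proof (induction "length Fs" arbitrary: Fs rule: less_induct)
  case less
  show ?case
  proof (cases "Fs = []")
    case True
    then show ?thesis
      by (simp add: mat_fun_const[OF assms(1)])
  next
    case False
    have "mat_fun R (\<lambda>x. stp (map (\<lambda>F. F x) (del i Fs)))" if "i < length Fs" for i
      by (rule less(1)) (use that less.prems in \<open>auto dest: in_set_takeD in_set_dropD\<close>)
    then have "mat_fun R (\<lambda>x. \<Sum>i<length Fs. mat_scale ((- 1) ^ i)
        ((Fs ! i) x ** stp (map (\<lambda>F. F x) (del i Fs))))"
      by (intro mat_fun_sum mat_fun_scale mat_fun_mult fun_ring_const assms(1)) (auto intro: less.prems)
    moreover have "(\<Sum>i<length Fs. mat_scale ((- 1) ^ i)
        ((Fs ! i) x ** stp (map (\<lambda>F. F x) (del i Fs)))) = stp (map (\<lambda>F. F x) Fs)" for x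
      using False by (subst stp_expand) (simp_all add: take_map drop_map)
    ultimately show ?thesis
      by simp
  qed
qed

lemma fun_ring_det:
  fixes F :: "'p \<Rightarrow> 'a::comm_ring_1 ^ 'n::finite ^ 'n"
  assumes "fun_ring R" "mat_fun R F"
  shows "(\<lambda>x. det (F x)) \<in> R"
  unfolding det_def
  by (intro fun_ring_sum fun_ring_mult fun_ring_prod fun_ring_const assms(1) mat_funD[OF assms(2)])

section \<open>Linear maps that are injective on matrices of given support\<close>

definition supported :: "('m \<times> 'n) set \<Rightarrow> 'a::zero ^ 'n ^ 'm \<Rightarrow> bool"
  where "supported P X \<longleftrightarrow> (\<forall>i j. (i, j) \<notin> P \<longrightarrow> X $ i $ j = 0)"

lemma supportedD: "supported P X \<Longrightarrow> X $ i $ j \<noteq> 0 \<Longrightarrow> (i, j) \<in> P"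
  by (auto simp: supported_def)

text \<open>Replaces a lower bound for the rank: for a linear map it says that the rank is at least
  \<open>card P\<close>, witnessed by a fixed set of positions.\<close>

definition inj_supported :: "('m \<times> 'n) set \<Rightarrow> ('a::zero ^ 'n ^ 'm \<Rightarrow> 'b::zero) \<Rightarrow> bool"
  where "inj_supported P f \<longleftrightarrow> (\<forall>X. supported P X \<longrightarrow> f X = 0 \<longrightarrow> X = 0)"

definition mat_linear :: "('a::field ^ 'n ^ 'm \<Rightarrow> 'a ^ 'k ^ 'l) \<Rightarrow> bool"
  where "mat_linear f \<longleftrightarrow> (\<forall>c X Y. f (mat_scale c X + Y) = mat_scale c (f X) + f Y)"

lemma mat_linear_add: "mat_linear f \<Longrightarrow> f (X + Y) = f X + f Y"
  by (metis mat_linear_def mat_vs.scale_one)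

lemma mat_linear_0: "mat_linear f \<Longrightarrow> f 0 = 0"
  using mat_linear_add[of f 0 0] by simp

lemma mat_linear_scale: "mat_linear f \<Longrightarrow> f (mat_scale c X) = mat_scale c (f X)"
proof -
  assume f: "mat_linear f"
  then have "f (mat_scale c X + 0) = mat_scale c (f X) + f 0"
    by (simp only: mat_linear_def)
  then show ?thesis
    by (simp add: mat_linear_0[OF f])
qed

lemma mat_linear_sum: "mat_linear f \<Longrightarrow> f (sum g S) = (\<Sum>s\<in>S. f (g s))"
  by (induction S rule: infinite_finite_induct) (simp_all add: mat_linear_0 mat_linear_add)

text \<open>A left inverse of the map at \<open>x0\<close>, kept fixed, gives a determinant that is
  1 at \<open>x0\<close> and whose nonvanishing forces injectivity at \<open>x\<close>.\<close>

lemma inj_supported_generic: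
  fixes \<Phi> :: "'p \<Rightarrow> 'a::field ^ 'n::finite ^ 'n \<Rightarrow> 'a ^ 'n ^ 'n"
  assumes R: "fun_ring R" and lin: "\<And>x. mat_linear (\<Phi> x)" and ent: "\<And>X. mat_fun R (\<lambda>x. \<Phi> x X)"
    and inj: "inj_supported P (\<Phi> x0)"
  shows "\<exists>p\<in>R. p x0 \<noteq> 0 \<and> (\<forall>x. p x \<noteq> 0 \<longrightarrow> inj_supported P (\<Phi> x))"
proof -
  \<comment> \<open>The matrix of \<open>\<Phi> x\<close> in the basis of matrix units, with the
    columns outside \<open>P\<close> erased.\<close>
  define M :: "'p \<Rightarrow> 'a ^ ('n \<times> 'n) ^ ('n \<times> 'n)" where
    "M x = (\<chi> r c. if c \<in> P then \<Phi> x (munit (fst c) (snd c)) $ fst r $ snd r else 0)" for x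
  define vc :: "'a ^ 'n ^ 'n \<Rightarrow> 'a ^ ('n \<times> 'n)" where "vc X = (\<chi> c. X $ fst c $ snd c)" for X
  define unvc :: "'a ^ ('n \<times> 'n) \<Rightarrow> 'a ^ 'n ^ 'n" where "unvc v = (\<chi> i j. v $ (i, j))" for v
  \<comment> \<open>The projection to the coordinates outside \<open>P\<close>; it makes up for the
    erased columns, so that the determinant of a square matrix can be used.\<close>
  define Q :: "'a ^ ('n \<times> 'n) ^ ('n \<times> 'n)" where "Q = (\<chi> r c. if r = c then if c \<in> P then 0 else 1 else 0)"
  have unvc: "vc (unvc v) = v" for v
    by (simp add: vc_def unvc_def vec_eq_iff)
  have M: "M x *v vc X = vc (\<Phi> x X)" if "supported P X" for x X
  proof -
    have "(M x *v vc X) $ r = vc (\<Phi> x X) $ r" for r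
    proof -
      have "(M x *v vc X) $ r = (\<Sum>c\<in>UNIV. X $ fst c $ snd c * \<Phi> x (munit (fst c) (snd c)) $ fst r $ snd r)"
        unfolding matrix_vector_mult_def M_def vc_def
        using that by (auto simp: supported_def intro!: sum.cong)
      also have "\<dots> = (\<Sum>a\<in>UNIV. \<Sum>b\<in>UNIV. X $ a $ b * \<Phi> x (munit a b) $ fst r $ snd r)"
        by (simp add: sum.cartesian_product case_prod_unfold)
      also have "\<dots> = \<Phi> x (\<Sum>a\<in>UNIV. \<Sum>b\<in>UNIV. mat_scale (X $ a $ b) (munit a b)) $ fst r $ snd r"
        by (simp add: mat_linear_sum[OF lin] mat_linear_scale[OF lin] sum_component)
      finally show ?thesis
        by (simp add: vc_def flip: mat_eq_sum_munit)
    qed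
    then show ?thesis
      by (simp add: vec_eq_iff)
  qed
  have Q: "(Q *v v) $ c = (if c \<in> P then 0 else v $ c)" for v c
    by (simp add: Q_def matrix_vector_mult_def if_distrib[of "\<lambda>z. z * _"] cong: if_cong)
  define V where "V = {v :: 'a ^ ('n \<times> 'n). \<forall>c. c \<notin> P \<longrightarrow> v $ c = 0}"
  have V: "vec.subspace V"
    by (rule vec.subspaceI) (auto simp: V_def)
  have V_sup: "supported P (unvc v)" if "v \<in> V" for v
    using that by (simp add: V_def supported_def unvc_def)
  have V_ker: "v = 0" if "v \<in> V" "M x *v v = 0" "inj_supported P (\<Phi> x)" for v x
  proof -
    have "vc (\<Phi> x (unvc v)) = 0"
      using M[OF V_sup[OF that(1)], of x] that(2) unvc by simp
    then have "\<Phi> x (unvc v) = 0"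
      by (simp add: vc_def vec_eq_iff)
    then have "unvc v = 0"
      using that(3) V_sup[OF that(1)] by (simp add: inj_supported_def)
    then show ?thesis
      by (simp add: unvc_def vec_eq_iff)
  qed
  have "inj_on ((*v) (M x0)) V"
  proof (rule inj_onI)
    fix v w
    assume "v \<in> V" "w \<in> V" "M x0 *v v = M x0 *v w"
    then show "v = w"
      using V_ker[of "v - w" x0] inj vec.subspace_diff[OF V] by (simp add: vec.diff)
  qed
  from vec.linear_exists_left_inverse_on[OF matrix_vector_mul_linear_gen V this]
  obtain g where g: "range g \<subseteq> V" "Vector_Spaces.linear (*s) (*s) g" "\<And>v. v \<in> V \<Longrightarrow> g (M x0 *v v) = v"
    by auto
  define p where "p x = det (matrix g ** M x + Q)" for x
  have "mat_fun R M"
    unfolding mat_fun_def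
  proof (intro allI)
    show "(\<lambda>x. M x $ r $ c) \<in> R" for r c
      using mat_funD[OF ent] fun_ring_const[OF R] by (cases "c \<in> P") (simp_all add: M_def)
  qed
  then have "p \<in> R"
    unfolding p_def by (intro fun_ring_det mat_fun_add mat_fun_mult mat_fun_const R)
  moreover have "p x0 \<noteq> 0"
  proof -
    \<comment> \<open>\<open>g\<close> undoes \<open>M x0\<close> on the coordinates in
      \<open>P\<close>, and \<open>Q\<close> restores the others.\<close>
    have "(matrix g ** M x0 + Q) *v v = v" for v
    proof -
      define w where "w = v - Q *v v"
      have w: "w \<in> V"
        by (simp add: w_def V_def Q)
      have "M x0 *v (Q *v v) = 0"
        unfolding matrix_vector_mult_def[of "M x0"]
        by (auto simp: vec_eq_iff M_def Q intro!: sum.neutral)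
      then have "M x0 *v v = M x0 *v w"
        by (simp add: w_def vec.diff)
      then have "matrix g *v (M x0 *v v) = w"
        using g(3)[OF w] by (simp add: matrix_works[OF g(2)])
      then show ?thesis
        by (simp add: matrix_vector_mult_add_rdistrib w_def matrix_vector_mul_assoc[symmetric])
    qed
    then have "matrix g ** M x0 + Q = mat 1"
      by (metis matrix_eq matrix_vector_mul_lid)
    then show ?thesis
      by (simp add: p_def)
  qed
  moreover have "inj_supported P (\<Phi> x)" if "p x \<noteq> 0" for x
    unfolding inj_supported_def
  proof (intro allI impI)
    fix X
    assume X: "supported P X" "\<Phi> x X = 0"
    have "M x *v vc X = 0"
      unfolding M[OF X(1)] X(2) by (simp add: vc_def vec_eq_iff)
    moreover have "Q *v vc X = 0"
      using X(1) by (auto simp: vec_eq_iff Q vc_def supported_def)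
    ultimately have "(matrix g ** M x + Q) *v vc X = 0"
      by (simp add: matrix_vector_mult_add_rdistrib matrix_vector_mul_assoc[symmetric])
    moreover have "invertible (matrix g ** M x + Q)"
      using that by (simp add: p_def invertible_det_nz)
    ultimately have "vc X = 0"
      by (metis invertible_left_inverse matrix_left_invertible_ker)
    then show "X = 0"
      by (simp add: vc_def vec_eq_iff)
  qed
  ultimately show ?thesis
    by blast
qed

section \<open>Polynomial functions and their restriction to lines\<close>

lemma fun_ring_mat_poly_fun: "fun_ring (mat_poly_fun k)"
  by (auto simp: fun_ring_def intro: mat_poly_fun.intros)

lemma mat_fun_coord: "i < k \<Longrightarrow> mat_fun (mat_poly_fun k) (\<lambda>As. As ! i)"
  by (auto simp: mat_fun_def intro: mat_poly_fun.intros)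

lemma fun_ring_poly: "fun_ring (range (poly :: 'a::comm_ring_1 poly \<Rightarrow> _))"
  unfolding fun_ring_def
proof (intro conjI allI ballI)
  fix c
  have "(\<lambda>_. c) = poly [:c:]"
    by (rule ext) simp
  then show "(\<lambda>_. c) \<in> range poly"
    by auto
next
  fix f g :: "'a \<Rightarrow> 'a"
  assume "f \<in> range poly" "g \<in> range poly"
  then obtain p q where "f = poly p" "g = poly q"
    by auto
  then have "(\<lambda>x. f x + g x) = poly (p + q)" "(\<lambda>x. f x * g x) = poly (p * q)"
    by auto
  then show "(\<lambda>x. f x + g x) \<in> range poly" "(\<lambda>x. f x * g x) \<in> range poly"
    by auto
qed

definition line :: "('a::field ^ 'n ^ 'm) list \<Rightarrow> ('a ^ 'n ^ 'm) list \<Rightarrow> 'a \<Rightarrow> ('a ^ 'n ^ 'm) list"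
  where "line As Bs t = map2 (\<lambda>A B. mat_scale (1 - t) A + mat_scale t B) As Bs"

lemma poly_line:
  assumes "p \<in> mat_poly_fun k" "length As = k" "length Bs = k"
  shows "(\<lambda>t. p (line As Bs t)) \<in> range poly"
  using assms(1)
proof induction
  case (coord i a b)
  have "(\<lambda>t. line As Bs t ! i $ a $ b) = poly [:As ! i $ a $ b, Bs ! i $ a $ b - As ! i $ a $ b:]"
    using coord assms(2,3) by (auto simp: line_def algebra_simps)
  then show ?case
    by auto
qed (auto intro: fun_ring_const fun_ring_add fun_ring_mult fun_ring_poly)

lemma line_0: "length As = length Bs \<Longrightarrow> line As Bs 0 = As"
  by (rule nth_equalityI) (simp_all add: line_def)

lemma line_1: "length As = length Bs \<Longrightarrow> line As Bs 1 = Bs"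
  by (rule nth_equalityI) (simp_all add: line_def)

text \<open>On the line through a point where \<open>p\<close> does not vanish and a point where the
  product of the other functions does not, both become nonzero polynomials in one variable, whose
  finitely many roots cannot exhaust an infinite field. Closure of \<open>C\<close> under lines
  takes the place of irreducibility.\<close>

lemma common_nonzero:
  fixes C :: "('a::field ^ 'n ^ 'n) list set"
  assumes inf: "infinite (UNIV :: 'a set)" and fin: "finite S" and S: "S \<subseteq> mat_poly_fun k"
    and len: "\<And>As. As \<in> C \<Longrightarrow> length As = k"
    and line: "\<And>As Bs t. As \<in> C \<Longrightarrow> Bs \<in> C \<Longrightarrow> line As Bs t \<in> C"
    and ne: "C \<noteq> {}" and nz: "\<And>p. p \<in> S \<Longrightarrow> \<exists>As\<in>C. p As \<noteq> 0"
  shows "\<exists>As\<in>C. \<forall>p\<in>S. p As \<noteq> 0"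
proof -
  have "\<exists>As\<in>C. (\<Prod>p\<in>S. p As) \<noteq> 0"
    using fin S nz
  proof (induction S rule: finite_induct)
    case empty
    then show ?case
      using ne by auto
  next
    case (insert p S)
    then obtain As Bs where AB: "As \<in> C" "(\<Prod>p\<in>S. p As) \<noteq> 0" "Bs \<in> C" "p Bs \<noteq> 0"
      by blast
    have "(\<lambda>As. \<Prod>p\<in>S. p As) \<in> mat_poly_fun k"
      by (intro fun_ring_prod fun_ring_mat_poly_fun) (use insert.prems in auto)
    then obtain f g where f: "(\<lambda>t. \<Prod>p\<in>S. p (line As Bs t)) = poly f"
      and g: "(\<lambda>t. p (line As Bs t)) = poly g"
      using poly_line[OF _ len[OF AB(1)] len[OF AB(3)]] insert.prems by fastforce
    have "f \<noteq> 0" "g \<noteq> 0"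
      using fun_cong[OF f, of 0] fun_cong[OF g, of 1] AB line_0[of As Bs] line_1[of As Bs] len
      by auto
    then have "finite {t. poly f t = 0}" "finite {t. poly g t = 0}"
      by (simp_all add: poly_roots_finite)
    then have "finite ({t. poly f t = 0} \<union> {t. poly g t = 0})"
      by simp
    then obtain t where "t \<notin> {t. poly f t = 0} \<union> {t. poly g t = 0}"
      using inf ex_new_if_finite by blast
    then have "p (line As Bs t) * (\<Prod>p\<in>S. p (line As Bs t)) \<noteq> 0"
      using fun_cong[OF f, of t] fun_cong[OF g, of t] by auto
    moreover have "(\<Prod>q\<in>insert p S. q (line As Bs t)) = p (line As Bs t) * (\<Prod>p\<in>S. p (line As Bs t))"
      using insert.hyps by simp
    ultimately show ?case
      using line[OF AB(1,3)] by metis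
  qed
  then show ?thesis
    using fin by (auto simp: prod_zero_iff)
qed

subsection \<open>Tuples on which the standard polynomial is invertible\<close>

text \<open>The fixed letters \<open>Ys\<close> and \<open>Zs\<close> and the index list
  \<open>js\<close> let one statement cover whole tuples, tuples without their first member, and
  words with constant matrices around them.\<close>

lemma mat_fun_stp_nth:
  assumes "set js \<subseteq> {..<k}"
  shows "mat_fun (mat_poly_fun k) (\<lambda>As. stp (Ys @ map (\<lambda>j. As ! j) js @ Zs))"
proof -
  let ?Fs = "map (\<lambda>Y _. Y) Ys @ map (\<lambda>j As. As ! j) js @ map (\<lambda>Z _. Z) Zs"
  have "mat_fun (mat_poly_fun k) (\<lambda>As. stp (map (\<lambda>F. F As) ?Fs))"
    by (rule mat_fun_stp[OF fun_ring_mat_poly_fun])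
      (use assms in \<open>auto intro: mat_fun_const[OF fun_ring_mat_poly_fun] mat_fun_coord\<close>)
  then show ?thesis
    by (simp add: comp_def)
qed

lemma supported_mult:
  assumes "supported (I \<times> J) A" "supported (J \<times> K) (B :: 'a::field ^ 'n ^ 'm)"
  shows "supported (I \<times> K) (A ** B)"
  using assms by (auto simp: supported_def mat_mul_nth intro!: sum.neutral)

lemma supported_line:
  assumes "supported P A" "supported P B"
  shows "supported P (mat_scale c A + mat_scale d (B :: 'a::field ^ 'n ^ 'm))"
  using assms by (auto simp: supported_def)

text \<open>The empty word is left out because \<open>stp []\<close> is the identity matrix.\<close>

lemma supported_stp:
  assumes "\<And>y. y \<in> set ys \<Longrightarrow> supported (I \<times> I) y" "ys \<noteq> []"
  shows "supported (I \<times> I) (stp ys)"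
  using assms
proof (induction "length ys" arbitrary: ys rule: less_induct)
  case less
  have "supported (I \<times> I) (ys ! i ** stp (del i ys))" if i: "i < length ys" for i
  proof (cases "del i ys = []")
    case True
    then show ?thesis
      using i less.prems by simp
  next
    case False
    have "supported (I \<times> I) (stp (del i ys))"
      by (rule less(1)) (use i False less.prems in \<open>auto dest: in_set_takeD in_set_dropD\<close>)
    then show ?thesis
      using i less.prems by (intro supported_mult) auto
  qed
  then show ?case
    unfolding stp_expand[OF less.prems(2)] by (auto simp: supported_def sum_component)
qed

section \<open>Staircases of matrix units\<close>

fun stair :: "(nat \<Rightarrow> 'n) \<Rightarrow> nat \<Rightarrow> nat \<Rightarrow> ('a::field ^ 'n ^ 'n) list"
  where
    "stair g k 0 = []"
  | "stair g k (Suc r) = munit (g k) (g k) # munit (g k) (g (Suc k)) # stair g (Suc k) r"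

lemma length_stair [simp]: "length (stair g k r) = 2 * r"
  by (induction r arbitrary: k) simp_all

lemma stair_column:
  "y \<in> set (stair g k r) \<Longrightarrow> y $ i $ c \<noteq> 0 \<Longrightarrow> \<exists>l. k \<le> l \<and> l \<le> k + r \<and> c = g l"
proof (induction r arbitrary: k)
  case (Suc r)
  consider "c = g k" | "c = g (Suc k)" | "y \<in> set (stair g (Suc k) r)"
    using Suc.prems by (auto simp: munit_nth split: if_splits)
  then show ?case
  proof cases
    case 1
    then show ?thesis
      by (intro exI[of _ k]) auto
  next
    case 2
    then show ?thesis
      by (intro exI[of _ "Suc k"]) auto
  next
    case 3
    then obtain l where "Suc k \<le> l" "l \<le> Suc k + r" "c = g l"
      using Suc.IH[OF 3 Suc.prems(2)] by blast
    then show ?thesis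
      by (intro exI[of _ l]) auto
  qed
qed simp

text \<open>The word follows a path with a loop at each vertex but the last. The path never returns,
  so by \<open>stp_source\<close> the letters can be multiplied only in the listed order, and
  dropping the first loop leaves the endpoints as they were.\<close>

lemma stp_stair:
  assumes "inj_on g {k..k + Suc r}"
  shows "stp (stair g k (Suc r)) = (munit (g k) (g (k + Suc r)) :: 'a::field ^ 'n::finite ^ 'n)"
    and "stp (tl (stair g k (Suc r))) = (munit (g k) (g (k + Suc r)) :: 'a ^ 'n ^ 'n)"
proof -
  have *: "stp (tl (stair g k (Suc r))) = (munit (g k) (g (k + Suc r)) :: 'a ^ 'n ^ 'n)
    \<and> stp (stair g k (Suc r)) = (munit (g k) (g (k + Suc r)) :: 'a ^ 'n ^ 'n)"
    using assms
  proof (induction r arbitrary: k)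
    case 0
    then have "g (Suc k) \<noteq> g k"
      by (simp add: inj_on_eq_iff)
    have "stp [munit (g k) (g k), munit (g k) (g (Suc k))]
        = munit (g k) (g k) ** stp [munit (g k) (g (Suc k)) :: 'a ^ 'n ^ 'n]"
      by (rule stp_source) (use \<open>g (Suc k) \<noteq> g k\<close> in \<open>auto simp: munit_mul_munit\<close>)
    then show ?case
      by (simp add: stp_expand munit_mul_munit)
  next
    case (Suc r)
    let ?rest = "stair g (Suc k) (Suc r) :: ('a ^ 'n ^ 'n) list"
    have IH: "stp ?rest = munit (g (Suc k)) (g (k + Suc (Suc r)))"
      using Suc.IH[of "Suc k"] inj_on_subset[OF Suc.prems, of "{Suc k..Suc k + Suc r}"] by simp
    have col: "y ** munit (g k) b = 0" if y: "y \<in> set ?rest" for y and b :: 'n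
    proof -
      have "y $ i $ g k = 0" for i
      proof (rule ccontr)
        assume "y $ i $ g k \<noteq> 0"
        then obtain l where "Suc k \<le> l" "l \<le> Suc k + Suc r" "g k = g l"
          using stair_column[OF y] by blast
        then show False
          using inj_on_eq_iff[OF Suc.prems, of k l] by simp
      qed
      then show ?thesis
        by (simp add: mul_munit_eq_0)
    qed
    have ne: "g (Suc k) \<noteq> g k"
      using Suc.prems by (simp add: inj_on_eq_iff)
    have "stp (munit (g k) (g (Suc k)) # ?rest) = munit (g k) (g (Suc k)) ** stp ?rest"
      by (rule stp_source) (rule col)
    then have 1: "stp (munit (g k) (g (Suc k)) # ?rest) = munit (g k) (g (k + Suc (Suc r)))"
      by (simp add: IH munit_mul_munit del: stair.simps)
    have "stp (munit (g k) (g k) # munit (g k) (g (Suc k)) # ?rest)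
        = munit (g k) (g k) ** stp (munit (g k) (g (Suc k)) # ?rest)"
      by (rule stp_source) (use ne col in \<open>auto simp: munit_mul_munit simp del: stair.simps\<close>)
    with 1 show ?case
      by (simp add: munit_mul_munit stair.simps(2)[of g k "Suc r"] del: stair.simps)
  qed
  from * show "stp (stair g k (Suc r)) = (munit (g k) (g (k + Suc r)) :: 'a ^ 'n ^ 'n)"
    and "stp (tl (stair g k (Suc r))) = (munit (g k) (g (k + Suc r)) :: 'a ^ 'n ^ 'n)"
    by simp_all
qed

text \<open>Added to a matrix supported on \<open>I \<times> I\<close>, it expresses invertibility
  of that block as invertibility over the whole index type.\<close>

definition id_outside :: "'n set \<Rightarrow> 'a::zero_neq_one ^ 'n ^ 'n"
  where "id_outside I = (\<chi> i j. if i = j \<and> i \<notin> I then 1 else 0)"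

lemma monomial_invertible:
  fixes M :: "'a::field ^ 'n::finite ^ 'n"
  assumes sup: "supported (I \<times> I) M" and f: "bij_betw f I I"
    and nz: "\<And>p. p \<in> I \<Longrightarrow> M $ p $ f p \<noteq> 0"
    and z: "\<And>p q. p \<in> I \<Longrightarrow> q \<noteq> f p \<Longrightarrow> M $ p $ q = 0"
  shows "invertible (M + id_outside I)"
proof -
  have "x = 0" if x: "(M + id_outside I) *v x = 0" for x
  proof -
    have row: "(\<Sum>q\<in>UNIV. (M + id_outside I) $ p $ q * x $ q) = 0" for p
      using arg_cong[OF x, of "\<lambda>v. v $ p"] by (simp add: matrix_vector_mult_def)
    have 1: "x $ p = 0" if "p \<notin> I" for p
    proof -
      have "(\<Sum>q\<in>UNIV. (M + id_outside I) $ p $ q * x $ q) = (\<Sum>q\<in>UNIV. if p = q then x $ q else 0)"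
        by (rule sum.cong) (use that sup in \<open>auto simp: supported_def id_outside_def\<close>)
      then show ?thesis
        using row by simp
    qed
    have 2: "x $ f p = 0" if "p \<in> I" for p
    proof -
      have "(\<Sum>q\<in>UNIV. (M + id_outside I) $ p $ q * x $ q)
          = (\<Sum>q\<in>UNIV. if f p = q then M $ p $ f p * x $ q else 0)"
        by (rule sum.cong) (use that z in \<open>auto simp: id_outside_def\<close>)
      then show ?thesis
        using row nz[OF that] by simp
    qed
    have "x $ p = 0" for p
    proof (cases "p \<in> I")
      case True
      then obtain p' where "p' \<in> I" "p = f p'"
        using bij_betw_imp_surj_on[OF f] by blast
      then show ?thesis
        by (simp add: 2)
    qed (rule 1)
    then show ?thesis
      by (simp add: vec_eq_iff)
  qed
  then show ?thesis
    by (metis invertible_left_inverse matrix_left_invertible_ker)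
qed


lemma homogeneous_line:
  assumes "homogeneous \<phi> m w A" "homogeneous \<phi> m w B"
  shows "homogeneous \<phi> m w (mat_scale c A + mat_scale d (B :: 'a::field ^ 'n ^ 'n))"
  unfolding homogeneous_def
proof (intro allI impI)
  fix p q
  assume "(mat_scale c A + mat_scale d B) $ p $ q \<noteq> 0"
  then have "A $ p $ q \<noteq> 0 \<or> B $ p $ q \<noteq> 0"
    by auto
  then show "m dvd \<phi> q - \<phi> p - w"
    using assms by (auto dest: homogeneousD)
qed

lemma homogeneous_stp_nth:
  assumes "\<And>j. j < length ys \<Longrightarrow> homogeneous \<phi> m (w j) (ys ! j :: 'a::field ^ 'n::finite ^ 'n)"
  shows "homogeneous \<phi> m (\<Sum>j<length ys. w j) (stp ys)"
proof -
  let ?zs = "zip ys (map w [0..<length ys])"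
  have "homogeneous \<phi> m (sum_list (map snd ?zs)) (stp (map fst ?zs))"
    by (rule homogeneous_stp) (use assms in \<open>auto simp: in_set_zip\<close>)
  moreover have "sum_list (map w [0..<length ys]) = (\<Sum>j<length ys. w j)"
    by (simp add: sum_list_distinct_conv_sum_set atLeast0LessThan)
  ultimately show ?thesis
    by simp
qed

text \<open>
  Number \<open>I\<close> cyclically and let the matrices be alternately of weight 0 (diagonal) and 1.  Then both
  standard polynomials have weight \<open>r\<close>, hence one entry in each row and column; each of these
  entries is 1 at some staircase of matrix units, so none of them vanishes generically.
\<close>

lemma exists_invertible_stp:
  fixes I :: "'n::finite set"
  assumes inf: "infinite (UNIV :: 'a::field set)" and r: "0 < r" and I: "r < card I"
  shows "\<exists>As :: ('a ^ 'n ^ 'n) list. length As = 2 * r \<and> (\<forall>A\<in>set As. supported (I \<times> I) A) \<and>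
    invertible (stp As + id_outside I) \<and> invertible (stp (tl As) + id_outside I)"
proof -
  define m where "m = card I"
  obtain h where h: "bij_betw h {0..<m} I"
    using ex_bij_betw_nat_finite[of I] by (auto simp: m_def)
  have m: "0 < m" "r < m"
    using I by (auto simp: m_def)
  \<comment> \<open>The cyclic numbering of \<open>I\<close>, extended periodically so that
    \<open>k + r\<close> needs no reduction.\<close>
  define g where "g k = h (k mod m)" for k
  define \<phi> where "\<phi> p = int (the_inv_into {0..<m} h p)" for p
  have h_inj: "inj_on h {0..<m}" and h_im: "h ` {0..<m} = I"
    using h by (auto simp: bij_betw_def)
  have \<phi>_g: "\<phi> (g k) = int (k mod m)" for k
    using m by (simp add: \<phi>_def g_def the_inv_into_f_f[OF h_inj])
  have g_I: "g k \<in> I" for k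
    using h_im m by (auto simp: g_def)
  have g_eq: "g k = g l \<longleftrightarrow> k mod m = l mod m" for k l
  proof
    assume "g k = g l"
    then have "\<phi> (g k) = \<phi> (g l)"
      by simp
    then show "k mod m = l mod m"
      unfolding \<phi>_g by simp
  qed (simp add: g_def)
  have g_surj: "\<exists>k<m. p = g k" if "p \<in> I" for p
    using that h_im by (auto simp: g_def)
  have dvd_g: "q = g (k + n)" if "q \<in> I" "int m dvd \<phi> q - \<phi> (g k) - int n" for q k n
  proof -
    obtain l where l: "l < m" "q = g l"
      using g_surj[OF \<open>q \<in> I\<close>] by blast
    then have "int m dvd int l - int (k mod m) - int n"
      using that by (simp add: \<phi>_g)
    then have "int l mod int m = (int (k mod m) + int n) mod int m"
      by (simp add: mod_eq_dvd_iff algebra_simps)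
    then have "l mod m = (k + n) mod m"
      by (metis mod_add_left_eq of_nat_add of_nat_eq_iff zmod_int)
    then show ?thesis
      by (simp add: l g_eq)
  qed
  define w :: "nat \<Rightarrow> int" where "w j = of_bool (odd j)" for j
  have w_sum: "(\<Sum>j<2 * n. w j) = int n" for n
    by (induction n) (simp_all add: w_def)
  define C where "C = {As :: ('a ^ 'n ^ 'n) list. length As = 2 * r \<and>
    (\<forall>j<2 * r. supported (I \<times> I) (As ! j) \<and> homogeneous \<phi> (int m) (w j) (As ! j))}"
  have S_hom: "homogeneous \<phi> (int m) (int r) (stp As)" if "As \<in> C" for As
    using homogeneous_stp_nth[of As \<phi> "int m" w] that by (simp add: C_def w_sum)
  have T_hom: "homogeneous \<phi> (int m) (int r) (stp (tl As))" if "As \<in> C" for As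
  proof -
    have "homogeneous \<phi> (int m) (\<Sum>j<length (tl As). w (Suc j)) (stp (tl As))"
      by (rule homogeneous_stp_nth) (use that in \<open>auto simp: C_def nth_tl\<close>)
    \<comment> \<open>Dropping the first letter costs no weight, as that letter has weight
      0.\<close>
    moreover have "(\<Sum>j<length (tl As). w (Suc j)) = (\<Sum>j<Suc (2 * r - 1). w j)"
      using that by (simp only: sum.lessThan_Suc_shift) (simp add: C_def w_def)
    ultimately show ?thesis
      using r w_sum[of r] by simp
  qed
  have inv: "invertible (M + id_outside I)"
    if "supported (I \<times> I) M" "homogeneous \<phi> (int m) (int r) M" "\<And>k. k < m \<Longrightarrow> M $ g k $ g (k + r) \<noteq> 0"
    for M :: "'a ^ 'n ^ 'n"
  proof (rule monomial_invertible[OF that(1)])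
    define f where "f p = g (nat (\<phi> p) + r)" for p
    have f_g: "f (g k) = g (k + r)" for k
      by (simp add: f_def \<phi>_g g_eq mod_add_left_eq)
    have "f ` I = I"
    proof
      show "I \<subseteq> f ` I"
      proof
        fix p
        assume "p \<in> I"
        then obtain k where k: "p = g k"
          using g_surj by blast
        then have "p = f (g (k + (m - r)))"
          using m by (simp add: f_g g_eq)
        then show "p \<in> f ` I"
          using g_I by blast
      qed
    qed (use g_I in \<open>auto simp: f_def\<close>)
    then show "bij_betw f I I"
      by (simp add: bij_betw_def eq_card_imp_inj_on)
    show "M $ p $ f p \<noteq> 0" if "p \<in> I" for p
      using g_surj[OF \<open>p \<in> I\<close>] f_g \<open>\<And>k. k < m \<Longrightarrow> M $ g k $ g (k + r) \<noteq> 0\<close> by auto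
    show "M $ p $ q = 0" if p: "p \<in> I" and q: "q \<noteq> f p" for p q
    proof (rule ccontr)
      assume nz: "M $ p $ q \<noteq> 0"
      then have "q \<in> I"
        using \<open>supported (I \<times> I) M\<close> by (auto simp: supported_def)
      moreover obtain k where k: "p = g k"
        using g_surj[OF p] by blast
      ultimately have "q = g (k + r)"
        using homogeneousD[OF \<open>homogeneous \<phi> (int m) (int r) M\<close> nz] by (intro dvd_g) auto
      then show False
        using q k f_g by simp
    qed
  qed
  define s where "s k As = stp ([] @ map (\<lambda>j. As ! j) [0..<2 * r] @ []) $ g k $ g (k + r)"
    for k and As :: "('a ^ 'n ^ 'n) list"
  define t where "t k As = stp ([] @ map (\<lambda>j. As ! j) [1..<2 * r] @ []) $ g k $ g (k + r)"
    for k and As :: "('a ^ 'n ^ 'n) list"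
  have s: "s k As = stp As $ g k $ g (k + r)" if "length As = 2 * r" for k As
    using map_nth[of As] that by (simp add: s_def)
  have t: "t k As = stp (tl As) $ g k $ g (k + r)" if "length As = 2 * r" for k As
  proof -
    have "map (\<lambda>j. As ! j) [1..<2 * r] = tl As"
      by (rule nth_equalityI) (use that in \<open>auto simp: nth_tl\<close>)
    then show ?thesis
      by (simp add: t_def)
  qed
  have stair_C: "stair g k r \<in> C" for k
  proof -
    have "supported (I \<times> I) (stair g k n ! j :: 'a ^ 'n ^ 'n) \<and> homogeneous \<phi> (int m) (w j) (stair g k n ! j :: 'a ^ 'n ^ 'n)"
      if "j < 2 * n" for j n
      using that
    proof (induction n arbitrary: k j)
      case (Suc n)
      have e: "homogeneous \<phi> (int m) 1 (munit (g k) (g (Suc k)) :: 'a ^ 'n ^ 'n)"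
        unfolding homogeneous_def
      proof (intro allI impI)
        fix p q
        assume "(munit (g k) (g (Suc k)) :: 'a ^ 'n ^ 'n) $ p $ q \<noteq> 0"
        then have "p = g k" "q = g (Suc k)"
          by (auto simp: munit_nth split: if_splits)
        then show "int m dvd \<phi> q - \<phi> p - 1"
          by (simp add: \<phi>_g zmod_int mod_eq_dvd_iff[symmetric] mod_simps algebra_simps)
      qed
      consider "j = 0" | "j = 1" | i where "j = Suc (Suc i)"
        by (metis One_nat_def not0_implies_Suc)
      then show ?case
      proof cases
        case 3
        then show ?thesis
          using Suc.IH[of i "Suc k"] Suc.prems by (simp add: w_def)
      qed (use e g_I in \<open>auto simp: supported_def munit_nth homogeneous_def w_def\<close>)
    qed simp
    then show ?thesis
      by (simp add: C_def)
  qed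
  have stair_1: "s k (stair g k r) \<noteq> 0 \<and> t k (stair g k r) \<noteq> 0" for k
  proof -
    \<comment> \<open>Since \<open>r < m\<close>, the \<open>r + 1\<close> consecutive numbers from
      \<open>k\<close> to \<open>k + r\<close> are distinct modulo \<open>m\<close>.\<close>
    have "inj_on g {k..k + r}"
    proof (rule inj_onI)
      fix i j
      assume ij: "i \<in> {k..k + r}" "j \<in> {k..k + r}" "g i = g j"
      have "a = b" if "a \<le> b" "b - a < m" "a mod m = b mod m" for a b :: nat
        using that mod_eq_dvd_iff_nat[of a b m] by (auto dest: dvd_imp_le)
      moreover have "i - j < m" "j - i < m" "i mod m = j mod m"
        using ij m by (auto simp: g_eq)
      ultimately show "i = j"
        by (metis nat_le_linear)
    qed
    then show ?thesis
      using stp_stair[of g k "r - 1", where 'a = 'a] r by (simp add: s t munit_nth)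
  qed
  have "\<exists>As\<in>C. \<forall>p\<in>s ` {..<m} \<union> t ` {..<m}. p As \<noteq> 0"
  proof (rule common_nonzero[OF inf])
    show "s ` {..<m} \<union> t ` {..<m} \<subseteq> mat_poly_fun (2 * r)"
      unfolding s_def t_def
      by (intro Un_least image_subsetI mat_funD[OF mat_fun_stp_nth]) auto
    show "line As Bs t \<in> C" if "As \<in> C" "Bs \<in> C" for As Bs t
      using that by (auto simp: C_def line_def intro!: supported_line homogeneous_line)
    show "\<exists>As\<in>C. p As \<noteq> 0" if "p \<in> s ` {..<m} \<union> t ` {..<m}" for p
      using that stair_C stair_1 by blast
    show "C \<noteq> {}"
      using stair_C by blast
  qed (auto simp: C_def)
  then obtain As where As: "As \<in> C" "\<And>k. k < m \<Longrightarrow> s k As \<noteq> 0 \<and> t k As \<noteq> 0"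
    by auto
  have len: "length As = 2 * r" and sup: "\<forall>A\<in>set As. supported (I \<times> I) A"
    using As(1) by (auto simp: C_def in_set_conv_nth)
  have "As \<noteq> []" "tl As \<noteq> []"
    using len r by (auto simp: tl_Nil)
  moreover have "\<forall>A\<in>set (tl As). supported (I \<times> I) A"
    using sup by (meson \<open>As \<noteq> []\<close> list.set_sel(2))
  ultimately have "invertible (stp As + id_outside I)" "invertible (stp (tl As) + id_outside I)"
    using As sup S_hom T_hom len s t by (auto intro!: inv supported_stp)
  with len sup show ?thesis
    by blast
qed

subsection \<open>Adding a row and a column\<close>

text \<open>\<open>P\<close> certifies that the operator has rank at least
  \<open>card I ^ 2 - 2 * r\<close> on the block; the equation is additive to avoid subtraction of
  natural numbers. The argument of type \<open>itself\<close> fixes the field, which the index set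
  does not show.\<close>

definition rank_attained :: "'a::field itself \<Rightarrow> nat \<Rightarrow> 'n::finite set \<Rightarrow> bool"
  where "rank_attained _ r I \<longleftrightarrow> (\<exists>(As :: ('a ^ 'n ^ 'n) list) P. length As = 2 * r \<and>
    (\<forall>A\<in>set As. supported (I \<times> I) A) \<and> P \<subseteq> I \<times> I \<and> card P + 2 * r = card I ^ 2 \<and>
    inj_supported P (\<lambda>X. stp (As @ [X])))"

lemma mult_eq_0_supported:
  assumes "supported (A \<times> B) X" "supported (C \<times> D) (Y :: 'a::field ^ 'n ^ 'm)" "B \<inter> C = {}"
  shows "X ** Y = 0"
proof (rule mat_eqI)
  fix i j
  have "X $ i $ k * Y $ k $ j = 0" for k
  proof -
    have "k \<notin> B \<or> k \<notin> C"
      using assms(3) by auto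
    then show ?thesis
      using assms(1,2) by (auto simp: supported_def)
  qed
  then show "(X ** Y) $ i $ j = 0 $ i $ j"
    by (simp add: mat_mul_nth sum.neutral)
qed

lemma supported_add_eq_0:
  assumes "supported P X" "supported Q Y" "P \<inter> Q = {}" "X + Y = (0 :: 'a::field ^ 'n ^ 'm)"
  shows "X = 0 \<and> Y = 0"
proof -
  have "X $ i $ j = 0 \<and> Y $ i $ j = 0" for i j
  proof -
    have "X $ i $ j + Y $ i $ j = 0"
      using arg_cong[OF assms(4), of "\<lambda>M. M $ i $ j"] by simp
    moreover have "(i, j) \<notin> P \<or> (i, j) \<notin> Q"
      using assms(3) by auto
    ultimately show ?thesis
      using assms(1,2) by (auto simp: supported_def)
  qed
  then show ?thesis
    by (simp add: vec_eq_iff)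
qed

lemma supported_mono: "supported P X \<Longrightarrow> P \<subseteq> Q \<Longrightarrow> supported Q X"
  by (auto simp: supported_def)

lemma id_outside_mult: "supported (I \<times> K) X \<Longrightarrow> id_outside I ** (X :: 'a::field ^ 'k ^ 'n::finite) = 0"
  by (rule mult_eq_0_supported[of UNIV "- I" _ I K]) (auto simp: supported_def id_outside_def)

lemma mult_id_outside: "supported (K \<times> I) X \<Longrightarrow> X ** id_outside I = (0 :: 'a::field ^ 'n::finite ^ 'k)"
  by (rule mult_eq_0_supported[of K I _ "- I" UNIV]) (auto simp: supported_def id_outside_def)

lemma mat_linear_stp: "mat_linear (\<lambda>X. stp (As @ [X]))"
  using stp_linear[of As _ _ _ "[]"] by (simp add: mat_linear_def)

text \<open>All three properties are guaranteed by the nonvanishing of polynomial functions on the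
  tuples supported on \<open>I \<times> I\<close>, and each function is nonzero at some such tuple,
  so one tuple has all three.\<close>

lemma rank_attained_generic:
  fixes I :: "'n::finite set"
  assumes inf: "infinite (UNIV :: 'a::field set)" and r: "0 < r" "r < card I" and rank_attained: "rank_attained TYPE('a) r I"
  shows "\<exists>(As :: ('a ^ 'n ^ 'n) list) P. length As = 2 * r \<and>
    (\<forall>A\<in>set As. supported (I \<times> I) A) \<and> P \<subseteq> I \<times> I \<and> card P + 2 * r = card I ^ 2 \<and>
    inj_supported P (\<lambda>X. stp (As @ [X])) \<and>
    invertible (stp As + id_outside I) \<and> invertible (stp (tl As) + id_outside I)"
proof -
  obtain As0 :: "('a ^ 'n ^ 'n) list" and P where As0: "length As0 = 2 * r"
      "\<forall>A\<in>set As0. supported (I \<times> I) A" "inj_supported P (\<lambda>X. stp (As0 @ [X]))"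
    and P: "P \<subseteq> I \<times> I" "card P + 2 * r = card I ^ 2"
    using rank_attained unfolding rank_attained_def by blast
  obtain Bs :: "('a ^ 'n ^ 'n) list" where Bs: "length Bs = 2 * r" "\<forall>A\<in>set Bs. supported (I \<times> I) A"
    "invertible (stp Bs + id_outside I)" "invertible (stp (tl Bs) + id_outside I)"
    using exists_invertible_stp[OF inf r] by blast
  define C where "C = {As :: ('a ^ 'n ^ 'n) list. length As = 2 * r \<and> (\<forall>j<2 * r. supported (I \<times> I) (As ! j))}"
  let ?c = "\<lambda>js Zs (As :: ('a ^ 'n ^ 'n) list). stp ([] @ map (\<lambda>j. As ! j) js @ Zs)"
  have all: "?c [0..<2 * r] Zs As = stp (As @ Zs)" if "length As = 2 * r" for Zs As
    using map_nth[of As] that by simp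
  have tl: "?c [1..<2 * r] [] As = stp (tl As)" if "length As = 2 * r" for As
  proof -
    have "map (\<lambda>j. As ! j) [1..<2 * r] = tl As"
      by (rule nth_equalityI) (use that in \<open>auto simp: nth_tl\<close>)
    then show ?thesis
      by simp
  qed
  have "\<exists>p\<in>mat_poly_fun (2 * r). p As0 \<noteq> 0 \<and>
      (\<forall>As. p As \<noteq> 0 \<longrightarrow> inj_supported P (\<lambda>X. ?c [0..<2 * r] [X] As))"
  proof (rule inj_supported_generic[OF fun_ring_mat_poly_fun])
    show "mat_linear (\<lambda>X. ?c [0..<2 * r] [X] As)" for As
      using mat_linear_stp by simp
    show "mat_fun (mat_poly_fun (2 * r)) (?c [0..<2 * r] [X])" for X
      by (rule mat_fun_stp_nth) auto
    show "inj_supported P (\<lambda>X. ?c [0..<2 * r] [X] As0)"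
      using As0 by (simp add: all del: append.simps)
  qed
  then obtain p where p: "p \<in> mat_poly_fun (2 * r)" "p As0 \<noteq> 0"
    "\<And>As. p As \<noteq> 0 \<Longrightarrow> inj_supported P (\<lambda>X. ?c [0..<2 * r] [X] As)"
    by blast
  define s where "s As = det (?c [0..<2 * r] [] As + id_outside I)" for As
  define t where "t As = det (?c [1..<2 * r] [] As + id_outside I)" for As
  have "\<exists>As\<in>C. \<forall>p\<in>{p, s, t}. p As \<noteq> 0"
  proof (rule common_nonzero[OF inf])
    have "s \<in> mat_poly_fun (2 * r)" "t \<in> mat_poly_fun (2 * r)"
      unfolding s_def t_def
      by (intro fun_ring_det mat_fun_add mat_fun_const fun_ring_mat_poly_fun mat_fun_stp_nth; auto)+
    with p(1) show "{p, s, t} \<subseteq> mat_poly_fun (2 * r)"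
      by simp
    show "line As Bs t \<in> C" if "As \<in> C" "Bs \<in> C" for As Bs t
      using that by (auto simp: C_def line_def intro!: supported_line)
    have "As0 \<in> C" "Bs \<in> C"
      using As0 Bs by (auto simp: C_def)
    moreover have "s Bs \<noteq> 0" "t Bs \<noteq> 0"
      using Bs unfolding s_def t_def all[OF Bs(1)] tl[OF Bs(1)] by (simp_all add: invertible_det_nz)
    ultimately show "\<exists>As\<in>C. f As \<noteq> 0" if "f \<in> {p, s, t}" for f
      using that p(2) by blast
    show "C \<noteq> {}"
      using \<open>As0 \<in> C\<close> by blast
  qed (auto simp: C_def)
  then obtain As where As: "As \<in> C" "p As \<noteq> 0" "s As \<noteq> 0" "t As \<noteq> 0"
    by auto
  then have len: "length As = 2 * r" and "\<forall>A\<in>set As. supported (I \<times> I) A"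
    by (auto simp: C_def in_set_conv_nth)
  moreover have "inj_supported P (\<lambda>X. stp (As @ [X]))"
    using p(3)[OF As(2)] unfolding all[OF len] .
  moreover have "invertible (stp As + id_outside I)" "invertible (stp (tl As) + id_outside I)"
    using As(3,4) unfolding s_def t_def all[OF len] tl[OF len] by (simp_all add: invertible_det_nz)
  ultimately show ?thesis
    using P by blast
qed


lemma homogeneous_0_1_add_eq_0:
  assumes "homogeneous \<phi> 2 0 X" "homogeneous \<phi> 2 1 Y" "X + Y = (0 :: 'a::field ^ 'n ^ 'n)"
  shows "X = 0 \<and> Y = 0"
proof -
  have "X $ i $ j = 0 \<and> Y $ i $ j = 0" for i j
  proof (rule ccontr)
    assume "\<not> (X $ i $ j = 0 \<and> Y $ i $ j = 0)"
    moreover have "X $ i $ j + Y $ i $ j = 0"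
      using arg_cong[OF assms(3), of "\<lambda>M. M $ i $ j"] by simp
    ultimately have "X $ i $ j \<noteq> 0" "Y $ i $ j \<noteq> 0"
      by auto
    then have "2 dvd \<phi> j - \<phi> i - 0" "2 dvd \<phi> j - \<phi> i - 1"
      using homogeneousD[OF assms(1)] homogeneousD[OF assms(2)] by blast+
    then show False
      by presburger
  qed
  then show ?thesis
    by (simp add: vec_eq_iff)
qed

definition block :: "('m \<times> 'n) set \<Rightarrow> 'a::zero ^ 'n ^ 'm \<Rightarrow> 'a ^ 'n ^ 'm"
  where "block P X = (\<chi> i j. if (i, j) \<in> P then X $ i $ j else 0)"

lemma block_nth: "block P X $ i $ j = (if (i, j) \<in> P then X $ i $ j else 0)"
  by (simp add: block_def)

lemma supported_block: "supported P (block P X)"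
  by (simp add: supported_def block_nth)

lemma block_add: "block P (X + Y) = block P X + block P (Y :: 'a::field ^ 'n ^ 'm)"
  by (simp add: vec_eq_iff block_nth)

lemma block_zero: "block P 0 = 0"
  by (simp add: vec_eq_iff block_nth)

lemma block_scale: "block P (mat_scale c X) = mat_scale c (block P X)"
  for c :: "'a::field"
  by (simp add: vec_eq_iff block_nth)

lemma stp_append1_eq_Cons:
  "even (length ys) \<Longrightarrow> stp (ys @ [y]) = stp (y # ys)"
  "odd (length ys) \<Longrightarrow> stp (ys @ [y]) = - stp (y # ys)"
  using stp_move[of "[]" ys y "[]"] by (simp_all add: mat_scale_uminus)

text \<open>
  One border row and column \<open>z\<close> is added to \<open>I\<close>.  With \<open>A = (a, b\<^sub>2, \<dots>)\<close> on \<open>I\<close>, the letter \<open>a\<close> is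
  perturbed to \<open>a + t D\<close> with \<open>D = c + \<rho>\<close>, where \<open>c\<close> lives in column \<open>z\<close> and \<open>\<rho>\<close> in row \<open>z\<close>.
  The two equations are the limit at \<open>t = 0\<close> of the kernel equation after rescaling the blocks
  \<open>I \<times> I\<close>, \<open>I \<times> z \<union> z \<times> I\<close>, \<open>z \<times> z\<close> of the argument by \<open>t\<^sup>2, t, 1\<close>.
\<close>

lemma border_limit:
  fixes I :: "'n::finite set" and a :: "'a::field ^ 'n ^ 'n"
  assumes two: "(2 :: 'a) \<noteq> 0" and z: "z \<notin> I" and len: "even (length (a # bs))"
    and sup: "\<And>A. A \<in> set (a # bs) \<Longrightarrow> supported (I \<times> I) A" and bs: "bs \<noteq> []"
    and inj: "inj_supported P (\<lambda>X. stp (a # bs @ [X]))" and P: "P \<subseteq> I \<times> I"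
    and S: "invertible (stp (a # bs) + id_outside I)"
    and c: "supported (I \<times> {z}) c" and \<rho>: "supported ({z} \<times> I) \<rho>" and \<xi>0: "supported (I \<times> {z}) \<xi>0"
    and Tc: "stp bs ** c = stp (a # bs) ** \<xi>0"
    and nz: "(\<rho> ** (stp bs ** \<xi>0)) $ z $ z \<noteq> 0"
    and X: "supported P X" and \<xi>: "supported (I \<times> {z}) \<xi>" and \<eta>: "supported ({z} \<times> I) \<eta>"
    and even: "stp (a # bs @ [X]) + stp ((c + \<rho>) # bs @ [\<xi> + \<eta>]) = 0"
    and odd: "stp (a # bs @ [\<xi> + \<eta>]) + mat_scale y (stp ((c + \<rho>) # bs @ [munit z z])) = 0"
  shows "X = 0 \<and> \<xi> = 0 \<and> \<eta> = 0 \<and> y = 0"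
proof -
  define S where "S = stp (a # bs)"
  define T where "T = stp bs"
  let ?e = "munit z z :: 'a ^ 'n ^ 'n"
  have e: "supported ({z} \<times> {z}) ?e"
    by (auto simp: supported_def munit_nth)
  have S_sup: "supported (I \<times> I) S" and T_sup: "supported (I \<times> I) T"
    unfolding S_def T_def using sup bs by (auto intro: supported_stp)
  have X_sup: "supported (I \<times> I) X"
    using X P by (rule supported_mono)
  have odd_bs: "odd (length bs)"
    using len by simp
  have Iz: "I \<inter> {z} = {}" "{z} \<inter> I = {}"
    using z by auto
  note zero = mult_eq_0_supported[OF _ _ Iz(1)] mult_eq_0_supported[OF _ _ Iz(2)]
  \<comment> \<open>The letters of \<open>a # bs\<close> live on \<open>I\<close>, so a letter in
    column \<open>z\<close> can only be followed by one in row \<open>z\<close>, and a letter in row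
    \<open>z\<close> can only be preceded by one in column \<open>z\<close>. This evaluates each of
    the following words.\<close>
  have \<alpha>\<xi>: "stp (a # bs @ [\<xi>]) = S ** \<xi>"
    unfolding S_def append_Cons[symmetric] by (rule stp_sink) (use zero(2)[OF \<xi>] sup in blast)
  have T\<xi>: "stp (bs @ [\<xi>]) = T ** \<xi>"
    unfolding T_def by (rule stp_sink) (use zero(2)[OF \<xi>] sup in auto)
  have \<alpha>\<eta>: "stp (a # bs @ [\<eta>]) = \<eta> ** S"
  proof -
    have "stp (a # bs @ [\<eta>]) = stp (\<eta> # a # bs)"
      using stp_append1_eq_Cons(1)[of "a # bs" \<eta>] odd_bs by simp
    also have "\<dots> = \<eta> ** S"
      unfolding S_def by (rule stp_source) (use zero(1)[OF _ \<eta>] sup in blast)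
    finally show ?thesis .
  qed
  \<comment> \<open>\<open>bs\<close> has odd length, so bringing \<open>c\<close> from the front to
    the end costs a sign.\<close>
  have c_bs: "stp (c # bs) = - (T ** c)"
  proof -
    have "stp (bs @ [c]) = T ** c"
      unfolding T_def by (rule stp_sink) (use zero(2)[OF c] sup in auto)
    then show ?thesis
      using stp_append1_eq_Cons(2)[OF odd_bs, of c] by (metis minus_minus)
  qed
  have \<rho>_bs: "stp (\<rho> # bs) = \<rho> ** T"
    unfolding T_def by (rule stp_source) (use zero(1)[OF _ \<rho>] sup in auto)
  have "T ** c ** ?e = T ** c"
  proof -
    have "c ** ?e = c"
      by (rule mat_eqI) (use c in \<open>auto simp: mul_munit_nth supported_def\<close>)
    then show ?thesis
      by (simp flip: matrix_mul_assoc)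
  qed
  moreover have "stp ((c # bs) @ [?e]) = stp (c # bs) ** ?e"
    by (rule stp_sink) (use zero(2)[OF e] c sup in auto)
  ultimately have c_e: "stp (c # bs @ [?e]) = - (T ** c)"
    by (simp add: c_bs mat_mul_uminus_left)
  have \<rho>_e: "stp (\<rho> # bs @ [?e]) = \<rho> ** T"
  proof -
    have "stp (\<rho> # bs @ [?e]) = stp (?e # \<rho> # bs)"
      using stp_append1_eq_Cons(1)[of "\<rho> # bs" ?e] odd_bs by simp
    also have "\<dots> = ?e ** stp (\<rho> # bs)"
      by (rule stp_source) (use zero(1)[OF _ e] \<rho> sup in auto)
    also have "\<dots> = ?e ** \<rho> ** T"
      by (simp add: \<rho>_bs matrix_mul_assoc)
    also have "?e ** \<rho> = \<rho>"
      by (rule mat_eqI) (use \<rho> in \<open>auto simp: munit_mul_nth supported_def\<close>)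
    finally show ?thesis .
  qed
  \<comment> \<open>The odd equation splits into its part in column \<open>z\<close> and its part in
    row \<open>z\<close>.\<close>
  have "(S ** \<xi> + mat_scale y (- (T ** c))) + (\<eta> ** S + mat_scale y (\<rho> ** T)) = 0"
  proof -
    have "stp (a # bs @ [\<xi> + \<eta>]) = S ** \<xi> + \<eta> ** S"
      using stp_add[of "a # bs" \<xi> \<eta> "[]"] by (simp add: \<alpha>\<xi> \<alpha>\<eta>)
    moreover have "stp ((c + \<rho>) # bs @ [?e]) = - (T ** c) + \<rho> ** T"
      using stp_add[of "[]" c \<rho> "bs @ [?e]"] by (simp add: c_e \<rho>_e)
    ultimately show ?thesis
      using odd by (simp only: mat_vs.scale_right_distrib) (simp only: ac_simps)
  qed
  moreover have "supported (I \<times> {z}) (S ** \<xi> + mat_scale y (- (T ** c)))"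
    using supported_mult[OF S_sup \<xi>] supported_mult[OF T_sup c] by (simp add: supported_def)
  moreover have "supported ({z} \<times> I) (\<eta> ** S + mat_scale y (\<rho> ** T))"
    using supported_mult[OF \<eta> S_sup] supported_mult[OF \<rho> T_sup] by (simp add: supported_def)
  moreover have "(I \<times> {z}) \<inter> ({z} \<times> I) = {}"
    using z by auto
  ultimately have 1: "S ** \<xi> + mat_scale y (- (T ** c)) = 0" and 2: "\<eta> ** S + mat_scale y (\<rho> ** T) = 0"
    using supported_add_eq_0 by blast+
  have inv: "S + id_outside I = S' \<Longrightarrow> invertible S'" for S'
    using S by (auto simp: S_def)
  then obtain V where V: "V ** (S + id_outside I) = mat 1" "(S + id_outside I) ** V = mat 1"
    unfolding invertible_def by metis
  have S_left: "Y = 0" if "S ** Y = 0" "supported (I \<times> K) Y" for Y and K :: "'n set"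
  proof -
    have "(S + id_outside I) ** Y = 0"
      by (simp add: mat_add_mul_left that id_outside_mult[OF that(2)])
    then have "V ** (S + id_outside I) ** Y = 0"
      by (simp flip: matrix_mul_assoc)
    then show ?thesis
      by (simp add: V)
  qed
  have S_right: "Y = 0" if "Y ** S = 0" "supported (K \<times> I) Y" for Y and K :: "'n set"
  proof -
    have "Y ** (S + id_outside I) = 0"
      by (simp add: matrix_add_ldistrib that mult_id_outside[OF that(2)])
    then have "Y ** ((S + id_outside I) ** V) = 0"
      by (simp add: matrix_mul_assoc)
    then show ?thesis
      by (simp add: V)
  qed
  \<comment> \<open>The column part says that \<open>S ** \<xi>\<close> is \<open>y\<close> times
    \<open>T ** c\<close>, that is \<open>y\<close> times \<open>S ** \<xi>0\<close>; on
    \<open>I\<close> the factor \<open>S\<close> can be cancelled.\<close>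
  have "\<xi> - mat_scale y \<xi>0 = 0"
  proof (rule S_left)
    have "S ** (\<xi> - mat_scale y \<xi>0) = S ** \<xi> + mat_scale y (- (T ** c))"
      using Tc unfolding diff_conv_add_uminus matrix_add_ldistrib
      by (simp add: mat_scale_simps S_def T_def)
    then show "S ** (\<xi> - mat_scale y \<xi>0) = 0"
      using 1 by simp
    show "supported (I \<times> {z}) (\<xi> - mat_scale y \<xi>0)"
      using \<xi> \<xi>0 by (simp add: supported_def)
  qed
  then have \<xi>_eq: "\<xi> = mat_scale y \<xi>0"
    by simp
  have \<eta>_eq: "\<eta> ** S = - mat_scale y (\<rho> ** T)"
    using 2 by (simp add: eq_neg_iff_add_eq_0)
  have c\<xi>: "stp (c # bs @ [\<xi>]) $ z $ z = 0"
  proof -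
    have "stp ((c # bs) @ [\<xi>]) = stp (c # bs) ** \<xi>"
      by (rule stp_sink) (use zero(2)[OF \<xi>] c sup in auto)
    also have "\<dots> = - (T ** (c ** \<xi>))"
      by (simp add: c_bs mat_mul_uminus_left matrix_mul_assoc)
    finally show ?thesis
      using zero(2)[OF c \<xi>] by simp
  qed
  \<comment> \<open>Left multiplication by \<open>?e\<close> keeps the entry at
    \<open>(z, z)\<close> and removes all rows but \<open>z\<close>, as needed for
    \<open>stp_first\<close>.\<close>
  have row: "M $ z $ z = (?e ** M) $ z $ z" for M :: "'a ^ 'n ^ 'n"
    by (simp add: munit_mul_nth)
  have \<rho>\<xi>: "stp (\<rho> # bs @ [\<xi>]) $ z $ z = (\<rho> ** (T ** \<xi>)) $ z $ z"
  proof -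
    have "?e ** stp (\<rho> # bs @ [\<xi>]) = ?e ** \<rho> ** stp (bs @ [\<xi>])"
      by (rule stp_first) (use zero(2)[OF e] \<xi> sup in auto)
    then show ?thesis
      unfolding T\<xi> by (metis matrix_mul_assoc row)
  qed
  have c\<eta>: "stp (c # bs @ [\<eta>]) $ z $ z = - (\<eta> ** (T ** c)) $ z $ z"
  proof -
    have "stp (c # bs @ [\<eta>]) = stp (\<eta> # c # bs)"
      using stp_append1_eq_Cons(1)[of "c # bs" \<eta>] odd_bs by simp
    moreover have "?e ** stp (\<eta> # c # bs) = ?e ** \<eta> ** stp (c # bs)"
      by (rule stp_first) (use zero(2)[OF e] c sup in auto)
    ultimately have "stp (c # bs @ [\<eta>]) $ z $ z = (\<eta> ** stp (c # bs)) $ z $ z"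
      by (metis matrix_mul_assoc row)
    then show ?thesis
      by (simp add: c_bs mat_mul_uminus_right)
  qed
  have \<rho>\<eta>: "stp (\<rho> # bs @ [\<eta>]) $ z $ z = 0"
  proof -
    have "stp (\<rho> # bs @ [\<eta>]) = stp (\<eta> # \<rho> # bs)"
      using stp_append1_eq_Cons(1)[of "\<rho> # bs" \<eta>] odd_bs by simp
    also have "\<dots> = \<eta> ** stp (\<rho> # bs)"
      by (rule stp_source) (use zero(1)[OF _ \<eta>] zero(1)[OF \<rho> \<eta>] sup in auto)
    also have "\<dots> = 0"
      using zero(1)[OF \<eta> \<rho>] by (simp add: \<rho>_bs matrix_mul_assoc)
    finally show ?thesis
      by simp
  qed
  have "supported (I \<times> I) (stp (a # bs @ [X]))"
    by (rule supported_stp) (use X_sup sup in auto)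
  then have "stp (a # bs @ [X]) $ z $ z = 0"
    using z by (simp add: supported_def)
  moreover have "stp ((c + \<rho>) # bs @ [\<xi> + \<eta>])
      = (stp (c # bs @ [\<xi>]) + stp (c # bs @ [\<eta>])) + (stp (\<rho> # bs @ [\<xi>]) + stp (\<rho> # bs @ [\<eta>]))"
    using stp_add[of "[]" c \<rho>] stp_add[of "c # bs" \<xi> \<eta> "[]"] stp_add[of "\<rho> # bs" \<xi> \<eta> "[]"] by simp
  ultimately have zz: "(\<rho> ** (T ** \<xi>)) $ z $ z - (\<eta> ** (T ** c)) $ z $ z = 0"
    using arg_cong[OF even, of "\<lambda>M. M $ z $ z"] by (simp add: c\<xi> \<rho>\<xi> c\<eta> \<rho>\<eta>)
  \<comment> \<open>The row part makes \<open>\<eta> ** (T ** c)\<close> the negative of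
    \<open>\<rho> ** (T ** \<xi>)\<close>; the difference in \<open>zz\<close> is therefore
    \<open>2 * y\<close> times the entry in \<open>nz\<close>.\<close>
  have "\<eta> ** (T ** c) = \<eta> ** S ** \<xi>0"
    using Tc by (simp add: S_def T_def matrix_mul_assoc)
  also have "\<dots> = - mat_scale y (\<rho> ** (T ** \<xi>0))"
    unfolding \<eta>_eq mat_mul_uminus_left mat_scale_mul_left matrix_mul_assoc ..
  finally have "(\<eta> ** (T ** c)) $ z $ z = - (y * (\<rho> ** (T ** \<xi>0)) $ z $ z)"
    by simp
  moreover have "(\<rho> ** (T ** \<xi>)) $ z $ z = y * (\<rho> ** (T ** \<xi>0)) $ z $ z"
    unfolding \<xi>_eq mat_scale_mul_right by simp
  ultimately have "2 * (y * (\<rho> ** (T ** \<xi>0)) $ z $ z) = 0"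
    using zz by (simp only: mult_2) simp
  then have y: "y = 0"
    using two nz by (simp add: T_def)
  moreover have \<xi>_0: "\<xi> = 0"
    using y by (simp add: \<xi>_eq)
  moreover have "\<eta> ** S = 0"
    using y by (simp add: \<eta>_eq)
  then have \<eta>_0: "\<eta> = 0"
    using S_right \<eta> by blast
  moreover have "stp (a # bs @ [X]) = 0"
    using even stp_zero[of "(c + \<rho>) # bs" "[]"] by (simp add: \<xi>_0 \<eta>_0)
  then have "X = 0"
    using inj X by (simp add: inj_supported_def)
  ultimately show ?thesis
    by simp
qed

text \<open>Injectivity at \<open>t = 0\<close> of the rescaled operator, supplied by
  \<open>border_limit\<close>, passes to some \<open>t \<noteq> 0\<close>; there the rescaling can
  be undone, and the perturbed tuple attains the rank on the larger index set.\<close>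

lemma rank_attained_insert:
  fixes I :: "'n::finite set"
  assumes inf: "infinite (UNIV :: 'a::field set)" and two: "(2 :: 'a) \<noteq> 0"
    and r: "0 < r" "r < card I" and z: "z \<notin> I" and rank_attained: "rank_attained TYPE('a) r I"
  shows "rank_attained TYPE('a) r (insert z I)"
proof -
  obtain As :: "('a ^ 'n ^ 'n) list" and P where len_As: "length As = 2 * r"
    and As: "\<forall>A\<in>set As. supported (I \<times> I) A" and P: "P \<subseteq> I \<times> I" "card P + 2 * r = card I ^ 2"
    and inj_As: "inj_supported P (\<lambda>X. stp (As @ [X]))"
    and inv: "invertible (stp As + id_outside I)" "invertible (stp (tl As) + id_outside I)"
    using rank_attained_generic[OF inf r rank_attained] by blast
  obtain a bs where As_eq: "As = a # bs"
    using len_As r by (cases As) auto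
  have bs: "bs \<noteq> []" and len: "length (a # bs) = 2 * r"
    using len_As r by (auto simp: As_eq)
  have sup: "supported (I \<times> I) A" if "A \<in> set (a # bs)" for A
    using As that by (auto simp: As_eq)
  have inj: "inj_supported P (\<lambda>X. stp (a # bs @ [X]))"
    using inj_As by (simp add: As_eq)
  let ?S = "stp (a # bs)" and ?T = "stp bs"
  have S_sup: "supported (I \<times> I) ?S" and T_sup: "supported (I \<times> I) ?T"
    using sup bs by (auto intro: supported_stp)
  obtain i0 where i0: "i0 \<in> I"
    using r by fastforce
  \<comment> \<open>\<open>\<xi>0\<close> is chosen first and \<open>c\<close> is solved from it by
    inverting \<open>stp bs\<close> on \<open>I\<close>, so that
    \<open>stp bs ** c = stp (a # bs) ** \<xi>0\<close> holds by construction.\<close>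
  define \<xi>0 where "\<xi>0 = (munit i0 z :: 'a ^ 'n ^ 'n)"
  have \<xi>0: "supported (I \<times> {z}) \<xi>0"
    using i0 by (auto simp: supported_def \<xi>0_def munit_nth)
  obtain W where W: "(?T + id_outside I) ** W = mat 1" "W ** (?T + id_outside I) = mat 1"
    using inv(2) unfolding invertible_def by (auto simp: As_eq)
  define c where "c = W ** (?S ** \<xi>0)"
  have Tc: "(?T + id_outside I) ** c = ?S ** \<xi>0"
    by (simp add: c_def matrix_mul_assoc W)
  have c: "supported (I \<times> {z}) c"
  proof -
    have "c $ i $ j = 0" if "i \<notin> I" for i j
    proof -
      have "((?T + id_outside I) ** c) $ i $ j = (\<Sum>k\<in>UNIV. if i = k then c $ k $ j else 0)"
        unfolding mat_mul_nth
        by (rule sum.cong) (use that T_sup in \<open>auto simp: supported_def id_outside_def\<close>)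
      moreover have "(?S ** \<xi>0) $ i $ j = 0"
        using supported_mult[OF S_sup \<xi>0] that by (simp add: supported_def)
      ultimately show ?thesis
        using Tc by simp
    qed
    moreover have "supported (UNIV \<times> {z}) c"
      unfolding c_def
    proof (rule supported_mult)
      show "supported (UNIV \<times> UNIV) W"
        by (simp add: supported_def)
      show "supported (UNIV \<times> {z}) (?S ** \<xi>0)"
        using supported_mult[OF S_sup \<xi>0] by (rule supported_mono) auto
    qed
    ultimately show ?thesis
      by (auto simp: supported_def)
  qed
  have Tc': "?T ** c = ?S ** \<xi>0"
    using Tc by (simp add: mat_add_mul_left id_outside_mult[OF c])
  \<comment> \<open>\<open>stp bs\<close> is invertible on \<open>I\<close>; a nonzero entry of its
    product with \<open>\<xi>0\<close> then selects the row \<open>\<rho>\<close>.\<close>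
  have "?T ** \<xi>0 \<noteq> 0"
  proof
    assume "?T ** \<xi>0 = 0"
    then have "(?T + id_outside I) ** \<xi>0 = 0"
      by (simp add: mat_add_mul_left id_outside_mult[OF \<xi>0])
    then have "W ** (?T + id_outside I) ** \<xi>0 = 0"
      by (simp flip: matrix_mul_assoc)
    then have "\<xi>0 = 0"
      by (simp add: W)
    then have "\<xi>0 $ i0 $ z = 0"
      by simp
    then show False
      by (simp add: \<xi>0_def munit_nth)
  qed
  then obtain i j where ij: "(?T ** \<xi>0) $ i $ j \<noteq> 0"
    by (auto simp: vec_eq_iff)
  then have i: "i \<in> I" "j = z"
    using supported_mult[OF T_sup \<xi>0] by (auto simp: supported_def)
  define \<rho> where "\<rho> = (munit z i :: 'a ^ 'n ^ 'n)"
  have \<rho>: "supported ({z} \<times> I) \<rho>"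
    using i by (auto simp: supported_def \<rho>_def munit_nth)
  have nz: "(\<rho> ** (?T ** \<xi>0)) $ z $ z \<noteq> 0"
    using ij i by (simp add: \<rho>_def munit_mul_nth)
  define D where "D = c + \<rho>"
  define \<alpha> where "\<alpha> Y = stp (a # bs @ [Y])" for Y
  define \<beta> where "\<beta> Y = stp (D # bs @ [Y])" for Y
  have lin: "mat_linear \<alpha>" "mat_linear \<beta>"
    using mat_linear_stp[of "a # bs"] mat_linear_stp[of "D # bs"] by (simp_all add: \<alpha>_def[abs_def] \<beta>_def[abs_def])
  \<comment> \<open>The three blocks are ordered by how many of the two indices equal
    \<open>z\<close>: none, one or two.\<close>
  define b0 :: "'a ^ 'n ^ 'n \<Rightarrow> 'a ^ 'n ^ 'n" where "b0 = block ((- {z}) \<times> (- {z}))"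
  define b1 :: "'a ^ 'n ^ 'n \<Rightarrow> 'a ^ 'n ^ 'n" where "b1 = block ((- {z}) \<times> {z} \<union> {z} \<times> (- {z}))"
  define b2 :: "'a ^ 'n ^ 'n \<Rightarrow> 'a ^ 'n ^ 'n" where "b2 = block ({(z, z)})"
  have b_sum: "Y = b0 Y + b1 Y + b2 Y" for Y :: "'a ^ 'n ^ 'n"
    by (auto simp: vec_eq_iff b0_def b1_def b2_def block_nth)
  have b_add: "b0 (Y + Z) = b0 Y + b0 Z" "b1 (Y + Z) = b1 Y + b1 Z" "b2 (Y + Z) = b2 Y + b2 Z"
    for Y Z :: "'a ^ 'n ^ 'n"
    by (simp_all add: b0_def b1_def b2_def block_add)
  have b_scale: "b0 (mat_scale s Y) = mat_scale s (b0 Y)" "b1 (mat_scale s Y) = mat_scale s (b1 Y)"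
    "b2 (mat_scale s Y) = mat_scale s (b2 Y)" for s and Y :: "'a ^ 'n ^ 'n"
    by (simp_all add: b0_def b1_def b2_def block_scale)
  have b_b: "b0 (b0 Y) = b0 Y" "b1 (b1 Y) = b1 Y" "b2 (b2 Y) = b2 Y"
    "b0 (b1 Y) = 0" "b0 (b2 Y) = 0" "b1 (b0 Y) = 0" "b1 (b2 Y) = 0" "b2 (b0 Y) = 0" "b2 (b1 Y) = 0"
    for Y :: "'a ^ 'n ^ 'n"
    by (auto simp: vec_eq_iff b0_def b1_def b2_def block_nth)
  \<comment> \<open>Modulo 2, the positions with exactly one index \<open>z\<close> are odd and all
    others even; \<open>D\<close> is odd and the old letters are even.\<close>
  define \<phi> where "\<phi> v = (of_bool (v = z) :: int)" for v
  have hom_I: "homogeneous \<phi> 2 0 A" if "supported (I \<times> I) A" for A :: "'a ^ 'n ^ 'n"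
    using that z by (force simp: homogeneous_def supported_def \<phi>_def)
  have hom_D: "homogeneous \<phi> 2 1 D"
    unfolding homogeneous_def
  proof (intro allI impI)
    fix p q
    assume "D $ p $ q \<noteq> 0"
    then have "c $ p $ q \<noteq> 0 \<or> \<rho> $ p $ q \<noteq> 0"
      by (auto simp: D_def)
    then have "(p \<in> I \<and> q = z) \<or> (p = z \<and> q \<in> I)"
      using supportedD[OF c] supportedD[OF \<rho>] by blast
    then show "2 dvd \<phi> q - \<phi> p - 1"
      using z by (auto simp: \<phi>_def)
  qed
  have hom_b: "homogeneous \<phi> 2 0 (b0 Y)" "homogeneous \<phi> 2 1 (b1 Y)" "homogeneous \<phi> 2 0 (b2 Y)"
    for Y :: "'a ^ 'n ^ 'n"
    by (auto simp: homogeneous_def b0_def b1_def b2_def block_nth \<phi>_def split: if_splits)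
  have hom_bs: "homogeneous \<phi> 2 (u + w) (stp (A # bs @ [Y]))"
    if "homogeneous \<phi> 2 u A" "homogeneous \<phi> 2 w Y" for A Y u w
  proof -
    let ?zs = "(A, u) # map (\<lambda>b. (b, 0)) bs @ [(Y, w)]"
    have "homogeneous \<phi> 2 (sum_list (map snd ?zs)) (stp (map fst ?zs))"
      by (rule homogeneous_stp) (use that hom_I sup in auto)
    then show ?thesis
      by (simp add: comp_def sum_list_triv)
  qed
  have hom_\<alpha>: "homogeneous \<phi> 2 w (\<alpha> Y)" if "homogeneous \<phi> 2 w Y" for w Y
    using hom_bs[OF hom_I[OF sup] that] by (simp add: \<alpha>_def)
  have hom_\<beta>0: "homogeneous \<phi> 2 1 (\<beta> Y)" if "homogeneous \<phi> 2 0 Y" for Y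
    using hom_bs[OF hom_D that] by (simp add: \<beta>_def)
  have hom_\<beta>1: "homogeneous \<phi> 2 0 (\<beta> Y)" if "homogeneous \<phi> 2 1 Y" for Y
  proof -
    have "homogeneous \<phi> 2 2 (\<beta> Y)"
      using hom_bs[OF hom_D that] by (simp add: \<beta>_def)
    then show ?thesis
      by (simp add: homogeneous_def)
  qed
  have hom_add: "homogeneous \<phi> 2 w (X + mat_scale s Y)"
    if "homogeneous \<phi> 2 w X" "homogeneous \<phi> 2 w Y" for w s and X Y :: "'a ^ 'n ^ 'n"
    using homogeneous_line[OF that, of 1 s] by simp
  have \<alpha>_b2: "\<alpha> (b2 Y) = 0" for Y
  proof -
    have b2_sup: "supported ({z} \<times> {z}) (b2 Y)"
      by (auto simp: b2_def supported_def block_nth)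
    have "stp ((a # bs) @ [b2 Y]) = ?S ** b2 Y"
      by (rule stp_sink)
        (use mult_eq_0_supported[OF b2_sup sup] z in blast)
    then show ?thesis
      using mult_eq_0_supported[OF S_sup b2_sup] z by (simp add: \<alpha>_def)
  qed
  \<comment> \<open>The left side of the kernel equation for \<open>a + t D\<close>, at the argument
    rescaled by \<open>t\<^sup>2\<close>, \<open>t\<close>, 1 on the three blocks, with its even
    part divided by \<open>t\<^sup>2\<close> and its odd part by \<open>t\<close>; the result is
    polynomial in \<open>t\<close>.\<close>
  define \<Phi> where "\<Phi> t Y = \<alpha> (b0 Y + b1 Y) + \<beta> (b1 Y) + \<beta> (b2 Y) + mat_scale (t * t) (\<beta> (b0 Y))"
    for t and Y :: "'a ^ 'n ^ 'n"
  \<comment> \<open>All of row and column \<open>z\<close> is added, \<open>2 * card I + 1\<close>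
    positions, which is exactly the growth of \<open>card I ^ 2\<close>.\<close>
  define P' where "P' = P \<union> ({z} \<times> insert z I \<union> I \<times> {z})"
  have split: "E = 0 \<and> O' = 0"
    if "homogeneous \<phi> 2 0 E" "homogeneous \<phi> 2 1 O'" "E + O' = 0" for E O' :: "'a ^ 'n ^ 'n"
    using homogeneous_0_1_add_eq_0[OF that] .
  have "inj_supported P' (\<Phi> 0)"
    unfolding inj_supported_def
  proof (intro allI impI)
    fix Y
    assume Y: "supported P' Y" "\<Phi> 0 Y = 0"
    have "(\<alpha> (b0 Y) + mat_scale 1 (\<beta> (b1 Y))) + (\<alpha> (b1 Y) + mat_scale 1 (\<beta> (b2 Y))) = 0"
      using Y(2) by (simp add: \<Phi>_def mat_linear_add[OF lin(1)] ac_simps)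
    then have eo: "\<alpha> (b0 Y) + mat_scale 1 (\<beta> (b1 Y)) = 0 \<and> \<alpha> (b1 Y) + mat_scale 1 (\<beta> (b2 Y)) = 0"
      by (intro split hom_add hom_\<alpha> hom_\<beta>0 hom_\<beta>1 hom_b)
    define \<xi> where "\<xi> = block (I \<times> {z}) Y"
    define \<eta> where "\<eta> = block ({z} \<times> I) Y"
    have b1: "b1 Y = \<xi> + \<eta>"
    proof (rule mat_eqI)
      fix p q
      show "b1 Y $ p $ q = (\<xi> + \<eta>) $ p $ q"
        using Y(1) P(1) z by (auto simp: b1_def \<xi>_def \<eta>_def block_nth supported_def P'_def)
    qed
    have b2: "b2 Y = mat_scale (Y $ z $ z) (munit z z)"
      by (auto simp: vec_eq_iff b2_def block_nth munit_nth)
    have b0_sup: "supported P (b0 Y)"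
      using Y(1) by (auto simp: supported_def b0_def block_nth P'_def)
    have "b0 Y = 0 \<and> \<xi> = 0 \<and> \<eta> = 0 \<and> Y $ z $ z = 0"
    proof (rule border_limit[OF two z _ sup bs inj P(1) _ c \<rho> \<xi>0 Tc' nz b0_sup])
      show "even (length (a # bs))"
        using len by simp
      show "invertible (stp (a # bs) + id_outside I)"
        using inv(1) by (simp add: As_eq)
      show "stp (a # bs @ [b0 Y]) + stp ((c + \<rho>) # bs @ [\<xi> + \<eta>]) = 0"
        using eo by (simp add: b1 \<alpha>_def \<beta>_def D_def)
      show "stp (a # bs @ [\<xi> + \<eta>]) + mat_scale (Y $ z $ z) (stp ((c + \<rho>) # bs @ [munit z z])) = 0"
        using eo unfolding b2 mat_linear_scale[OF lin(2)] by (simp add: b1 \<alpha>_def \<beta>_def D_def)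
    qed (simp_all add: \<xi>_def \<eta>_def supported_block)
    then show "Y = 0"
      using b_sum[of Y] by (simp add: b1 b2)
  qed
  moreover have "mat_linear (\<Phi> t)" for t
    unfolding mat_linear_def \<Phi>_def
    by (auto simp: b_add b_scale mat_linear_add[OF lin(1)] mat_linear_add[OF lin(2)]
        mat_linear_scale[OF lin(1)] mat_linear_scale[OF lin(2)] vec_eq_iff algebra_simps)
  moreover have "mat_fun (range poly) (\<lambda>t. \<Phi> t Y)" for Y
  proof -
    have "(\<lambda>t. t) = poly [:0, 1 :: 'a:]"
      by (rule ext) simp
    then have "(\<lambda>t :: 'a. t * t) \<in> range poly"
      by (intro fun_ring_mult fun_ring_poly) auto
    then show ?thesis
      unfolding \<Phi>_def by (intro mat_fun_add mat_fun_scale mat_fun_const fun_ring_poly)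
  qed
  ultimately obtain p where p: "p \<in> range poly" "p 0 \<noteq> 0" "\<And>t. p t \<noteq> 0 \<Longrightarrow> inj_supported P' (\<Phi> t)"
    using inj_supported_generic[OF fun_ring_poly, of \<Phi> P' 0] by blast
  then obtain f where f: "p = poly f"
    by blast
  with p(2) have "f \<noteq> 0"
    by auto
  then have "finite (insert 0 {t. poly f t = 0})"
    by (simp add: poly_roots_finite)
  \<comment> \<open>0 is excluded because the rescaling has to be inverted.\<close>
  then obtain t where "t \<notin> insert 0 {t. poly f t = 0}"
    using inf ex_new_if_finite by blast
  then have t: "t \<noteq> 0" "inj_supported P' (\<Phi> t)"
    using p(3) f by auto
  define a' where "a' = a + mat_scale t D"
  have L: "stp (a' # bs @ [Y]) = \<alpha> Y + mat_scale t (\<beta> Y)" for Y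
    using stp_linear[of "[]" t D a "bs @ [Y]"] by (simp add: a'_def \<alpha>_def \<beta>_def add.commute)
  have "inj_supported P' (\<lambda>Y. stp ((a' # bs) @ [Y]))"
    unfolding inj_supported_def
  proof (intro allI impI)
    fix Y
    assume Y: "supported P' Y" "stp ((a' # bs) @ [Y]) = 0"
    have \<alpha>Y: "\<alpha> Y = \<alpha> (b0 Y) + \<alpha> (b1 Y)"
      using mat_linear_add[OF lin(1)] \<alpha>_b2 by (subst b_sum[of Y]) simp
    have \<beta>Y: "\<beta> Y = \<beta> (b0 Y) + \<beta> (b1 Y) + \<beta> (b2 Y)"
      using mat_linear_add[OF lin(2)] by (subst b_sum[of Y]) simp
    have "(\<alpha> (b0 Y) + mat_scale t (\<beta> (b1 Y)))
        + ((\<alpha> (b1 Y) + mat_scale t (\<beta> (b0 Y))) + mat_scale t (\<beta> (b2 Y))) = 0"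
      using Y(2) L[of Y] by (simp add: \<alpha>Y \<beta>Y mat_vs.scale_right_distrib ac_simps)
    then have eo: "\<alpha> (b0 Y) + mat_scale t (\<beta> (b1 Y)) = 0
        \<and> (\<alpha> (b1 Y) + mat_scale t (\<beta> (b0 Y))) + mat_scale t (\<beta> (b2 Y)) = 0"
      by (intro split hom_add hom_\<alpha> hom_\<beta>0 hom_\<beta>1 hom_b)
    define s where "s = inverse t"
    have s: "s * t = 1" "t * s = 1" "s \<noteq> 0"
      using t by (auto simp: s_def)
    \<comment> \<open>The inverse rescaling of \<open>Y\<close>, which carries the kernel equation
      of the perturbed tuple to \<open>\<Phi> t Z = 0\<close>.\<close>
    define Z where "Z = mat_scale (s * s) (b0 Y) + mat_scale s (b1 Y) + b2 Y"
    have bZ: "b0 Z = mat_scale (s * s) (b0 Y)" "b1 Z = mat_scale s (b1 Y)" "b2 Z = b2 Y"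
      by (simp_all add: Z_def b_add b_scale b_b mat_scale_simps)
    have "\<Phi> t Z = mat_scale (s * s) (\<alpha> (b0 Y) + mat_scale t (\<beta> (b1 Y)))
        + mat_scale s ((\<alpha> (b1 Y) + mat_scale t (\<beta> (b0 Y))) + mat_scale t (\<beta> (b2 Y)))"
    proof -
      have "t * t * (s * s) = 1" "s * s * t = s"
        using s by (simp_all add: mult.assoc mult.left_commute)
      then show ?thesis
        unfolding \<Phi>_def bZ mat_linear_add[OF lin(1)]
          mat_linear_scale[OF lin(1)] mat_linear_scale[OF lin(2)] mat_vs.scale_right_distrib mat_vs.scale_scale
        by (simp add: s ac_simps)
    qed
    then have "\<Phi> t Z = 0"
      using eo by simp
    moreover have "supported P' Z"
      using Y(1) by (simp add: supported_def Z_def b0_def b1_def b2_def block_nth)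
    ultimately have "Z = 0"
      using t(2) by (simp add: inj_supported_def)
    then have "mat_scale (s * s) (b0 Y) = 0" "mat_scale s (b1 Y) = 0" "b2 Y = 0"
      unfolding bZ[symmetric] by (simp_all add: b0_def b1_def b2_def block_zero)
    then have "b0 Y = 0" "b1 Y = 0" "b2 Y = 0"
      using s by (simp_all add: mat_vs.scale_eq_0_iff)
    then show "Y = 0"
      using b_sum[of Y] by simp
  qed
  moreover have "\<forall>A\<in>set (a' # bs). supported (insert z I \<times> insert z I) A"
  proof -
    have "supported (insert z I \<times> insert z I) A" if "A \<in> set (a # bs)" for A
      using sup[OF that] by (rule supported_mono) auto
    moreover have "supported (insert z I \<times> insert z I) D"
      using c \<rho> by (auto simp: D_def supported_def)
    ultimately show ?thesis
      by (auto simp: a'_def supported_def)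
  qed
  moreover have "P' \<subseteq> insert z I \<times> insert z I"
    using P by (auto simp: P'_def)
  moreover have "card P' + 2 * r = card (insert z I) ^ 2"
  proof -
    have "card ({z} \<times> insert z I \<union> I \<times> {z}) = card ({z} \<times> insert z I) + card (I \<times> {z})"
      by (rule card_Un_disjoint) (use z in auto)
    then have "card ({z} \<times> insert z I \<union> I \<times> {z}) = 2 * card I + 1"
      using z by (simp add: card_cartesian_product)
    moreover have "card P' = card P + card ({z} \<times> insert z I \<union> I \<times> {z})"
      unfolding P'_def by (rule card_Un_disjoint) (use z P in \<open>auto intro: finite_subset\<close>)
    ultimately show ?thesis
      using P(2) z by (simp add: power2_eq_square)
  qed
  ultimately show ?thesis
    unfolding rank_attained_def using len by (intro exI[of _ "a' # bs"] exI[of _ P']) simp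
qed

subsection \<open>Matrix units along a cycle\<close>

definition cycle_edges :: "'n list \<Rightarrow> ('n \<times> 'n) list"
  where "cycle_edges vs = zip vs (rotate1 vs)"

lemma set_cycle_edges: "set (cycle_edges vs) \<subseteq> set vs \<times> set vs"
  by (auto simp: cycle_edges_def dest: set_zip_leftD set_zip_rightD)

lemma zip_rotate1: "length xs = length ys \<Longrightarrow> zip (rotate1 xs) (rotate1 ys) = rotate1 (zip xs ys)"
  by (cases xs; cases ys) simp_all

lemma cycle_edges_rotate: "cycle_edges (rotate k vs) = rotate k (cycle_edges vs)"
proof (induction k)
  case (Suc k)
  have "cycle_edges (rotate1 ws) = rotate1 (cycle_edges ws)" for ws :: "'a list"
    by (simp add: cycle_edges_def zip_rotate1)
  then show ?case
    by (simp add: Suc)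
qed simp

lemma mset_rotate: "mset (rotate k xs) = mset xs"
proof (induction k)
  case (Suc k)
  have "mset (rotate1 ys) = mset ys" for ys :: "'a list"
    by (cases ys) simp_all
  then show ?case
    by (simp add: Suc)
qed simp

text \<open>Where a cycle is cut open affects only the order of its edges, hence at most a sign of
  the standard polynomial.\<close>

lemma cycle_edges_append: "mset (cycle_edges (as @ bs)) = mset (cycle_edges (bs @ as))"
proof -
  have "cycle_edges (bs @ as) = rotate (length as) (cycle_edges (as @ bs))"
    by (simp add: rotate_append flip: cycle_edges_rotate)
  then show ?thesis
    by (simp add: mset_rotate)
qed

lemma cycle_edges_irrefl:
  assumes "distinct vs" "2 \<le> length vs"
  shows "(a, a) \<notin> set (cycle_edges vs)"
proof
  assume "(a, a) \<in> set (cycle_edges vs)"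
  then obtain i where i: "i < length vs" "vs ! i = a" "rotate1 vs ! i = a"
    by (auto simp: cycle_edges_def in_set_zip)
  then have "vs ! (Suc i mod length vs) = vs ! i"
    by (simp add: nth_rotate1)
  moreover have "Suc i mod length vs < length vs"
    using assms(2) by (intro mod_less_divisor) linarith
  ultimately have "Suc i mod length vs = i"
    using assms(1) i(1) by (simp add: nth_eq_iff_index_eq)
  then show False
    using assms(2) i(1) by (cases "Suc i = length vs") auto
qed

abbreviation unit_of :: "'n \<times> 'n \<Rightarrow> 'a::field ^ 'n ^ 'n"
  where "unit_of e \<equiv> munit (fst e) (snd e)"

lemma path_word_column:
  "y \<in> set (path_word u xs w) \<Longrightarrow> c \<notin> set xs \<Longrightarrow> c \<noteq> w \<Longrightarrow> y $ k $ c = 0"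
  by (induction xs arbitrary: u) (auto simp: munit_nth)

lemma mset_path_word:
  "mset (path_word u xs w) = mset (map unit_of (zip (u # xs) (xs @ [w]))) + mset (map (\<lambda>v. munit v v) xs)"
  by (induction xs arbitrary: u) simp_all

text \<open>
  The edges of a cycle have total weight zero for every grading of the vertices.
\<close>

lemma cycle_homogeneous:
  fixes Ds :: "('a::field ^ 'n::finite ^ 'n) list"
  assumes Ds: "\<And>D. D \<in> set Ds \<Longrightarrow> supported (Id_on I) D"
    and nz: "stp (map unit_of (cycle_edges vs) @ Ds @ [munit a b]) $ p $ q \<noteq> 0"
  shows "if a = b then p = q else p = a \<and> q = b"
proof -
  have "\<phi> q - \<phi> p = \<phi> b - \<phi> a" for \<phi> :: "'n \<Rightarrow> int"
  proof -
    let ?zs = "map (\<lambda>e. (unit_of e :: 'a ^ 'n ^ 'n, \<phi> (snd e) - \<phi> (fst e))) (cycle_edges vs)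
      @ map (\<lambda>D. (D, 0)) Ds @ [(munit a b, \<phi> b - \<phi> a)]"
    have 1: "map fst ?zs = map unit_of (cycle_edges vs) @ Ds @ [munit a b]"
      by (simp add: comp_def)
    have "sum_list (map (\<lambda>e. \<phi> (snd e)) (zip xs ys)) = sum_list (map \<phi> ys)"
      "sum_list (map (\<lambda>e. \<phi> (fst e)) (zip xs ys)) = sum_list (map \<phi> xs)"
      if "length xs = length ys" for xs ys :: "'n list"
      using that by (induction xs ys rule: list_induct2) simp_all
    moreover have "sum_list (map \<phi> (rotate1 vs)) = sum_list (map \<phi> vs)"
      by (cases vs) simp_all
    ultimately have "sum_list (map (\<lambda>e. \<phi> (snd e) - \<phi> (fst e)) (cycle_edges vs)) = 0"
      by (simp add: cycle_edges_def sum_list_subtractf)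
    then have 2: "sum_list (map snd ?zs) = \<phi> b - \<phi> a"
      by (simp add: comp_def sum_list_triv)
    have "homogeneous \<phi> 0 0 D" if "D \<in> set Ds" for D
      using supportedD[OF Ds[OF that]] by (auto simp: homogeneous_def)
    then have "homogeneous \<phi> 0 (sum_list (map snd ?zs)) (stp (map fst ?zs))"
      by (intro homogeneous_stp) (auto simp: homogeneous_def munit_nth split: if_splits)
    then show ?thesis
      using nz unfolding 1 2 by (auto dest: homogeneousD)
  qed
  \<comment> \<open>The indicator functions of \<open>a\<close>, \<open>b\<close> and
    \<open>p\<close> already force the claim.\<close>
  from this[of "\<lambda>v. of_bool (v = a)"] this[of "\<lambda>v. of_bool (v = b)"] this[of "\<lambda>v. of_bool (v = p)"]
  show ?thesis
    by (auto simp: of_bool_def split: if_splits)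
qed

text \<open>A cycle with loops at all vertices except \<open>p\<close> and its successor
  \<open>u\<close>, and an extra edge from \<open>p\<close> to \<open>q\<close>: contracting
  \<open>xs\<close> and \<open>ys\<close> leaves the word of
  \<open>stp_offdiag_word\<close>.\<close>

lemma cycle_offdiag:
  fixes p u q :: "'n::finite"
  assumes "distinct (p # u # xs @ q # ys)"
  shows "stp ([munit p u] @ path_word u xs q @ path_word q ys p @ [munit p q, munit q q]) $ p $ q
    = (2 :: 'a::field)"
proof -
  have col: "y $ k $ v = 0" if "y \<in> set (path_word q ys p)" "v \<in> set xs"
    for k v and y :: "'a ^ 'n ^ 'n"
    by (rule path_word_column[OF that(1)]) (use that(2) assms in auto)
  have "stp ([munit p u] @ path_word u xs q @ (path_word q ys p @ [munit p q, munit q q])) $ p $ q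
      = (stp ([munit p u] @ munit u q # path_word q ys p @ [munit p q, munit q q]) $ p $ q :: 'a)"
    by (rule stp_contract_path) (use assms in \<open>auto simp: munit_nth col\<close>)
  also have "\<dots> = stp ([munit p u, munit u q] @ path_word q ys p @ [munit p q, munit q q]) $ p $ q"
    by simp
  also have "\<dots> = stp ([munit p u, munit u q] @ munit q p # [munit p q, munit q q]) $ p $ q"
    by (rule stp_contract_path) (use assms in \<open>auto simp: munit_nth\<close>)
  finally show ?thesis
    using stp_offdiag_word[of p u q] assms by simp
qed

lemma cycle_diag:
  fixes x y z v :: "'n::finite"
  assumes "distinct (x # y # z # xs)" "v = x \<or> v = y" "i = x \<or> i = z"
  shows "stp ([munit x y, munit y z] @ path_word z xs x @ [munit v v, munit z z]) $ i $ i
    = (if v = x then 2 else if i = x then - 1 else - 2 :: 'a::field)"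
proof -
  have "stp ([munit x y, munit y z] @ path_word z xs x @ [munit v v, munit z z]) $ i $ i
      = (stp ([munit x y, munit y z] @ munit z x # [munit v v, munit z z]) $ i $ i :: 'a)"
    by (rule stp_contract_path) (use assms in \<open>auto simp: munit_nth\<close>)
  then show ?thesis
    using stp_diag_word1[of x y z, where 'a = 'a] assms by auto
qed


text \<open>The tuple has the \<open>r + 1\<close> edges of the cycle and \<open>r - 1\<close>
  diagonal matrices. \<open>P\<close> consists of the \<open>(r + 1)\<^sup>2 - 2 (r + 1)\<close>
  off-diagonal positions off the cycle and of two diagonal positions, which leaves out exactly
  \<open>2 r\<close> positions.\<close>

lemma rank_attained_base:
  fixes I :: "'n::finite set"
  assumes inf: "infinite (UNIV :: 'a::field set)" and two: "(2 :: 'a) \<noteq> 0"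
    and three: "r = 1 \<Longrightarrow> (3 :: 'a) \<noteq> 0" and r: "0 < r" and I: "card I = Suc r"
  shows "rank_attained TYPE('a) r I"
proof -
  obtain vs where vs: "set vs = I" "distinct vs" "length vs = Suc r"
    using finite_distinct_list[of I] I by (metis distinct_card finite)
  obtain x y rest where vs_eq: "vs = x # y # rest"
    using vs(3) r by (cases vs; cases "tl vs") auto
  define E where "E = (map unit_of (cycle_edges vs) :: ('a ^ 'n ^ 'n) list)"
  define L where "L Ds a b = stp (E @ Ds @ [munit a b])" for Ds :: "('a ^ 'n ^ 'n) list" and a b
  \<comment> \<open>The second row of the 2 by 2 minor; a third vertex exists only for
    \<open>r > 1\<close>.\<close>
  define z where "z = (if rest = [] then y else hd rest)"
  define C where "C = {Ds :: ('a ^ 'n ^ 'n) list. length Ds = r - 1 \<and> (\<forall>j<r - 1. supported (Id_on I) (Ds ! j))}"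
  \<comment> \<open>The minor of the diagonal block with columns \<open>x\<close>, \<open>y\<close>
    and rows \<open>x\<close>, \<open>z\<close>.\<close>
  define \<Delta> where "\<Delta> Ds = L Ds x x $ x $ x * L Ds y y $ z $ z - L Ds x x $ z $ z * L Ds y y $ x $ x" for Ds
  define N where "N = {(p, q). p \<in> I \<and> q \<in> I \<and> p \<noteq> q \<and> (p, q) \<notin> set (cycle_edges vs)}"
  have loops: "map (\<lambda>v. munit v v) ws \<in> C" if "set ws \<subseteq> I" "length ws = r - 1" for ws
    using that by (auto simp: C_def supported_def munit_nth Id_on_def subset_iff)
  have N: "\<exists>Ds\<in>C. L Ds p q $ p $ q \<noteq> 0" if pq: "(p, q) \<in> N" for p q
  proof -
    obtain as bs where as_bs: "vs = as @ p # bs"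
      using pq vs(1) by (auto simp: N_def dest: split_list)
    \<comment> \<open>The cycle is cut open at \<open>p\<close>, whose successor is then the first
      vertex of \<open>ws\<close>; \<open>q\<close> differs from it, as \<open>(p, q)\<close> is not
      an edge.\<close>
    define ws where "ws = bs @ as"
    have edges: "mset (cycle_edges vs) = mset (cycle_edges (p # ws))"
      using cycle_edges_append[of as "p # bs"] by (simp add: as_bs ws_def)
    have ws: "distinct (p # ws)" "set (p # ws) = I" "length ws = r"
      using vs by (auto simp: as_bs ws_def)
    then obtain u ws' where ws': "ws = u # ws'"
      using r by (cases ws) auto
    have "(p, u) \<in> set (cycle_edges vs)"
      using mset_eq_setD[OF edges] by (simp add: cycle_edges_def ws')
    then have "q \<in> set ws'"
      using pq ws(2) by (auto simp: N_def ws')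
    then obtain xs ys where ws'_eq: "ws' = xs @ q # ys"
      by (auto dest: split_list)
    \<comment> \<open>Loops at all vertices but \<open>p\<close> and \<open>u\<close>, in the number
      \<open>r - 1\<close> required by \<open>C\<close>.\<close>
    let ?Ds = "map (\<lambda>v. munit v v) (xs @ q # ys) :: ('a ^ 'n ^ 'n) list"
    have "mset (E @ ?Ds @ [munit p q])
        = mset ([munit p u] @ path_word u xs q @ path_word q ys p @ [munit p q, munit q q])"
    proof -
      have "cycle_edges (p # ws) = (p, u) # zip (u # xs) (xs @ [q]) @ zip (q # ys) (ys @ [p])"
        using zip_append[of "u # xs" "xs @ [q]" "q # ys" "ys @ [p]"]
        by (simp add: cycle_edges_def ws' ws'_eq)
      then have "mset E = mset (map unit_of ((p, u) # zip (u # xs) (xs @ [q]) @ zip (q # ys) (ys @ [p])))"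
        unfolding E_def mset_map edges by simp
      then show ?thesis
        by (simp add: mset_path_word)
    qed
    then have "L ?Ds p q $ p $ q \<noteq> 0"
      using stp_mset_eq cycle_offdiag[of p u xs q ys, where 'a = 'a] ws(1) two
      unfolding L_def by (fastforce simp: ws' ws'_eq)
    moreover have "?Ds \<in> C"
      by (rule loops) (use ws in \<open>auto simp: ws' ws'_eq\<close>)
    ultimately show ?thesis
      by blast
  qed
  have \<Delta>: "\<exists>Ds\<in>C. \<Delta> Ds \<noteq> 0"
  proof (cases rest)
    case Nil
    then have r1: "r = 1"
      using vs(3) by (simp add: vs_eq)
    have "L [] v v = stp [munit x y, munit y x, munit v v]" for v
      by (simp add: L_def E_def cycle_edges_def vs_eq Nil)
    then have "\<Delta> [] = - 3"
      using stp_diag_word2[of x y, where 'a = 'a] vs(2) by (simp add: \<Delta>_def z_def Nil vs_eq)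
    moreover have "[] \<in> C"
      by (simp add: C_def r1)
    ultimately show ?thesis
      using three[OF r1] by (metis neg_equal_0_iff_equal)
  next
    case (Cons z' xs)
    then have z: "z = z'"
      by (simp add: z_def)
    have dist: "distinct (x # y # z # xs)"
      using vs(2) by (simp add: vs_eq Cons z)
    let ?Ds = "map (\<lambda>v. munit v v) (z # xs) :: ('a ^ 'n ^ 'n) list"
    define M where "M v = (stp ([munit x y, munit y z] @ path_word z xs x @ [munit v v, munit z z]) :: 'a ^ 'n ^ 'n)"
      for v
    have "mset (E @ ?Ds @ [munit v v])
        = mset ([munit x y, munit y z] @ path_word z xs x @ [munit v v, munit z z])" for v
      by (simp add: E_def mset_path_word cycle_edges_def vs_eq Cons z flip: mset_map)
    \<comment> \<open>The unknown signs may differ for \<open>v = x\<close> and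
      \<open>v = y\<close>, but \<open>\<Delta>\<close> is linear in each of the two matrices, so it
      changes at most by a sign.\<close>
    then have L: "L ?Ds v v = M v \<or> L ?Ds v v = - M v" for v
      unfolding L_def M_def by (rule stp_mset_eq)
    have M: "M x $ x $ x = 2" "M x $ z $ z = 2" "M y $ x $ x = - 1" "M y $ z $ z = - 2"
      using dist cycle_diag[OF dist, where 'a = 'a] by (auto simp: M_def)
    have "\<Delta> ?Ds = 2 \<or> \<Delta> ?Ds = - 2"
      using L[of x] L[of y] M by (auto simp: \<Delta>_def)
    moreover have "?Ds \<in> C"
      by (rule loops) (use vs in \<open>auto simp: vs_eq Cons z\<close>)
    ultimately show ?thesis
      using two by (metis neg_equal_0_iff_equal)
  qed
  \<comment> \<open>On \<open>C\<close> these are entries of \<open>L\<close>, written through the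
    coordinates of \<open>Ds\<close> so that they are polynomial functions.\<close>
  define g where "g e Ds = stp (E @ map (\<lambda>j. Ds ! j) [0..<r - 1] @ [unit_of e]) $ fst e $ snd e" for e Ds
  define h where "h p v Ds = stp (E @ map (\<lambda>j. Ds ! j) [0..<r - 1] @ [munit v v]) $ p $ p" for p v Ds
  define \<delta> where "\<delta> Ds = h x x Ds * h z y Ds - h z x Ds * h x y Ds" for Ds
  have gL: "g (p, q) Ds = L Ds p q $ p $ q" "h p v Ds = L Ds v v $ p $ p" if "Ds \<in> C" for Ds p q v
    using that map_nth[of Ds] by (auto simp: g_def h_def L_def C_def)
  have \<delta>: "\<delta> Ds = \<Delta> Ds" if "Ds \<in> C" for Ds
    using that by (simp add: \<delta>_def \<Delta>_def gL)
  have "\<exists>Ds\<in>C. \<forall>f\<in>insert \<delta> (g ` N). f Ds \<noteq> 0"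
  proof (rule common_nonzero[OF inf])
    have "g e \<in> mat_poly_fun (r - 1)" "h p v \<in> mat_poly_fun (r - 1)" for e p v
      unfolding g_def h_def by (rule mat_funD[OF mat_fun_stp_nth]; auto)+
    then show "insert \<delta> (g ` N) \<subseteq> mat_poly_fun (r - 1)"
      unfolding \<delta>_def by (auto intro!: fun_ring_diff fun_ring_mult fun_ring_mat_poly_fun)
    show "line Ds Ds' t \<in> C" if "Ds \<in> C" "Ds' \<in> C" for Ds Ds' t
      using that by (auto simp: C_def line_def intro!: supported_line)
    show "C \<noteq> {}"
      using \<Delta> by blast
    show "\<exists>Ds\<in>C. f Ds \<noteq> 0" if f: "f \<in> insert \<delta> (g ` N)" for f
    proof (cases "f = \<delta>")
      case True
      then show ?thesis
        using \<Delta> \<delta> by auto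
    next
      case False
      then obtain p q where pq: "(p, q) \<in> N" "f = g (p, q)"
        using f by auto
      then show ?thesis
        using N[OF pq(1)] gL(1) by auto
    qed
  qed (auto simp: C_def)
  then obtain Ds where Ds: "Ds \<in> C" "\<Delta> Ds \<noteq> 0" "\<And>p q. (p, q) \<in> N \<Longrightarrow> L Ds p q $ p $ q \<noteq> 0"
    using \<delta> gL(1) by fastforce
  have Ds_sup: "supported (Id_on I) D" if "D \<in> set Ds" for D
    using Ds(1) that by (auto simp: C_def in_set_conv_nth)
  have L_eq_0: "L Ds a b $ p $ q = 0" if "\<not> (if a = b then p = q else p = a \<and> q = b)" for a b p q
    using cycle_homogeneous[of Ds I vs a b p q] Ds_sup that unfolding L_def E_def by blast
  define P where "P = N \<union> {(x, x), (y, y)}"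
  have xy: "x \<noteq> y" "x \<in> I" "y \<in> I"
    using vs by (auto simp: vs_eq)
  have "inj_supported P (\<lambda>X. stp ((E @ Ds) @ [X]))"
    unfolding inj_supported_def
  proof (intro allI impI)
    fix X
    assume X: "supported P X" "stp ((E @ Ds) @ [X]) = 0"
    have "(\<Sum>a\<in>UNIV. \<Sum>b\<in>UNIV. mat_scale (X $ a $ b) (L Ds a b)) = 0"
    proof -
      have "(\<Sum>a\<in>UNIV. \<Sum>b\<in>UNIV. mat_scale (X $ a $ b) (L Ds a b))
          = stp ((E @ Ds) @ [\<Sum>a\<in>UNIV. \<Sum>b\<in>UNIV. mat_scale (X $ a $ b) (munit a b)])"
        by (simp add: L_def mat_linear_sum[OF mat_linear_stp] mat_linear_scale[OF mat_linear_stp]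
            del: append_assoc flip: append_assoc)
      then show ?thesis
        using X(2) by (simp flip: mat_eq_sum_munit)
    qed
    then have entry: "(\<Sum>a\<in>UNIV. \<Sum>b\<in>UNIV. X $ a $ b * L Ds a b $ p $ q) = 0" for p q
      by (simp add: vec_eq_iff sum_component)
    \<comment> \<open>By homogeneity an off-diagonal entry of the image sees only the entry of
      \<open>X\<close> at the same position.\<close>
    have X_N: "X $ p $ q = 0" if pq: "(p, q) \<in> N" for p q
    proof -
      have "p \<noteq> q"
        using pq by (simp add: N_def)
      have "(\<Sum>b\<in>UNIV. X $ a $ b * L Ds a b $ p $ q)
          = (\<Sum>b\<in>UNIV. if q = b then if p = a then X $ p $ q * L Ds p q $ p $ q else 0 else 0)" for a
        by (rule sum.cong[OF refl]) (use L_eq_0[of a _ p q] \<open>p \<noteq> q\<close> in \<open>auto split: if_splits\<close>)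
      then have "X $ p $ q * L Ds p q $ p $ q = 0"
        using entry[of p q] by simp
      then show ?thesis
        using Ds(3)[OF pq] by simp
    qed
    have diag: "X $ x $ x * L Ds x x $ p $ p + X $ y $ y * L Ds y y $ p $ p = 0" for p
    proof -
      have "X $ a $ b * L Ds a b $ p $ p = 0" if "a \<noteq> b \<or> (a \<noteq> x \<and> a \<noteq> y)" for a b
        using that L_eq_0[of a b p p] X(1) by (cases "a = b") (auto simp: supported_def P_def N_def)
      then have "(\<Sum>b\<in>UNIV. X $ a $ b * L Ds a b $ p $ p)
          = (\<Sum>b\<in>UNIV. if a = b then X $ a $ a * L Ds a a $ p $ p else 0)" for a
        by (intro sum.cong) auto
      then have "(\<Sum>a\<in>UNIV. X $ a $ a * L Ds a a $ p $ p) = 0"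
        using entry[of p p] by simp
      moreover have "(\<Sum>a\<in>UNIV. X $ a $ a * L Ds a a $ p $ p)
          = (\<Sum>a\<in>{x, y}. X $ a $ a * L Ds a a $ p $ p)"
        by (rule sum.mono_neutral_right)
          (use \<open>\<And>a b. a \<noteq> b \<or> (a \<noteq> x \<and> a \<noteq> y) \<Longrightarrow> X $ a $ b * L Ds a b $ p $ p = 0\<close> in auto)
      ultimately show ?thesis
        using xy by simp
    qed
    \<comment> \<open>Cramer's rule for the two equations at \<open>x\<close> and
      \<open>z\<close>.\<close>
    have "X $ x $ x * \<Delta> Ds = 0" "X $ y $ y * \<Delta> Ds = 0"
      using diag[of x] diag[of z] unfolding \<Delta>_def by algebra+
    then have X_xy: "X $ x $ x = 0" "X $ y $ y = 0"
      using Ds(2) by auto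
    show "X = 0"
    proof (rule mat_eqI)
      fix p q
      show "X $ p $ q = 0 $ p $ q"
        using X(1) X_N X_xy by (cases "(p, q) \<in> P") (auto simp: P_def supported_def)
    qed
  qed
  moreover have "length (E @ Ds) = 2 * r"
    using Ds(1) vs(3) r by (simp add: E_def C_def cycle_edges_def)
  moreover have "\<forall>A\<in>set (E @ Ds). supported (I \<times> I) A"
  proof -
    have "supported (I \<times> I) D" if "D \<in> set Ds" for D
      using Ds_sup[OF that] by (rule supported_mono) auto
    moreover have "supported (I \<times> I) (unit_of e :: 'a ^ 'n ^ 'n)" if "e \<in> set (cycle_edges vs)" for e
      using that vs(1) set_cycle_edges[of vs] by (auto simp: supported_def munit_nth)
    ultimately show ?thesis
      by (auto simp: E_def)
  qed
  moreover have "P \<subseteq> I \<times> I"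
    using xy by (auto simp: P_def N_def)
  moreover have "card P + 2 * r = card I ^ 2"
  proof -
    let ?Z = "set (cycle_edges vs)"
    have Z: "?Z \<subseteq> I \<times> I" "card ?Z = Suc r" "?Z \<inter> Id_on I = {}"
      using vs cycle_edges_irrefl[OF vs(2)] r
      by (auto simp: cycle_edges_def distinct_card distinct_zipI1 dest: set_zip_leftD set_zip_rightD)
    have "Id_on I = (\<lambda>v. (v, v)) ` I"
      by auto
    then have Id: "card (Id_on I) = Suc r"
      by (simp add: card_image inj_on_def I)
    have "card (?Z \<union> Id_on I) = 2 * Suc r"
      using Z Id by (subst card_Un_disjoint) (auto simp: Id_on_def)
    moreover have N_eq: "N = I \<times> I - (?Z \<union> Id_on I)"
      by (auto simp: N_def)
    ultimately have "card N = Suc r * Suc r - 2 * Suc r"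
      using Z by (subst N_eq, subst card_Diff_subset) (auto simp: card_cartesian_product I)
    moreover have "card P = card N + card {(x, x), (y, y)}"
      unfolding P_def by (rule card_Un_disjoint) (auto simp: N_def)
    \<comment> \<open>Since \<open>r\<close> is positive, no truncation occurs in the difference
      above.\<close>
    moreover have "2 * Suc r \<le> Suc r * Suc r"
      using r by (intro mult_le_mono1) simp
    ultimately show ?thesis
      using xy(1) by (simp add: I power2_eq_square)
  qed
  ultimately show ?thesis
    unfolding rank_attained_def by (intro exI[of _ "E @ Ds"] exI[of _ P]) blast
qed

subsection \<open>Dimension count\<close>

text \<open>Starting from any \<open>r + 1\<close> indices, the remaining ones are added one at a
  time.\<close>

lemma rank_attained_UNIV:
  assumes inf: "infinite (UNIV :: 'a::field set)" and two: "(2 :: 'a) \<noteq> 0"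
    and three: "r = 1 \<Longrightarrow> (3 :: 'a) \<noteq> 0" and r: "0 < r" "r < CARD('n::finite)"
  shows "rank_attained TYPE('a) r (UNIV :: 'n set)"
proof -
  obtain I0 :: "'n set" where I0: "card I0 = Suc r"
    using obtain_subset_with_card_n[of "Suc r" "UNIV :: 'n set"] r by (auto simp: Suc_le_eq)
  have "rank_attained TYPE('a) r (I0 \<union> K)" if "K \<inter> I0 = {}" for K
    using finite[of K] that
  proof (induction K rule: finite_induct)
    case empty
    then show ?case
      using rank_attained_base[OF inf two three r(1) I0] by simp
  next
    case (insert z K)
    have "r < card (I0 \<union> K)"
      using I0 card_mono[of "I0 \<union> K" I0] by simp
    then show ?case
      using rank_attained_insert[OF inf two r(1), of "I0 \<union> K" z] insert by auto
  qed
  from this[of "- I0"] show ?thesis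
    by simp
qed

section \<open>Dimensions of spaces of matrices\<close>

interpretation mat_fd: finite_dimensional_vector_space
    "mat_scale :: 'a::field \<Rightarrow> 'a ^ 'n::finite ^ 'm::finite \<Rightarrow> 'a ^ 'n ^ 'm"
    "(\<lambda>e. munit (fst e) (snd e)) ` UNIV"
proof unfold_locales
  let ?B = "(\<lambda>e. munit (fst e) (snd e)) ` UNIV :: ('a ^ 'n ^ 'm) set"
  show "finite ?B"
    by simp
  show "\<not> mat_vs.dependent ?B"
  proof (rule mat_vs.independent_if_scalars_zero)
    fix f and X :: "'a ^ 'n ^ 'm"
    assume 0: "(\<Sum>X\<in>?B. mat_scale (f X) X) = 0" and "X \<in> ?B"
    then obtain e where e: "X = munit (fst e) (snd e)"
      by blast
    have "0 = (\<Sum>d\<in>UNIV. mat_scale (f (munit (fst d) (snd d))) (munit (fst d) (snd d) :: 'a ^ 'n ^ 'm)) $ fst e $ snd e"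
      using 0 by (simp add: sum.reindex[OF inj_munit])
    also have "\<dots> = (\<Sum>d\<in>UNIV. if e = d then f X else 0)"
      unfolding sum_component
      by (rule sum.cong) (auto simp: munit_nth e prod_eq_iff)
    finally show "f X = 0"
      by simp
  qed simp
  have "X \<in> mat_vs.span ?B" for X :: "'a ^ 'n ^ 'm"
  proof -
    have "(\<Sum>a\<in>UNIV. \<Sum>b\<in>UNIV. mat_scale (X $ a $ b) (munit a b)) \<in> mat_vs.span ?B"
      by (intro mat_vs.span_sum mat_vs.span_scale mat_vs.span_base) (auto simp: image_iff intro: exI[of _ "(_, _)"])
    then show ?thesis
      by (simp flip: mat_eq_sum_munit)
  qed
  then show "mat_vs.span ?B = UNIV"
    by blast
qed

lemma dim_mat_UNIV: "mat_vs.dim (UNIV :: ('a::field ^ 'n::finite ^ 'n) set) = CARD('n) ^ 2"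
  by (simp add: mat_fd.dim_UNIV card_image[OF inj_munit] power2_eq_square)

lemma subspace_kernel: "mat_linear f \<Longrightarrow> mat_vs.subspace {X. f X = 0}"
  by (intro mat_vs.subspaceI) (simp_all add: mat_linear_0 mat_linear_add mat_linear_scale)

text \<open>The matrices supported on \<open>P\<close> meet the kernel only in 0, so the two
  dimensions add up to at most that of the whole space.\<close>

lemma nullity_le:
  fixes f :: "'a::field ^ 'n::finite ^ 'n \<Rightarrow> 'a ^ 'n ^ 'n"
  assumes lin: "mat_linear f" and inj: "inj_supported P f"
  shows "card P + nullity f \<le> CARD('n) ^ 2"
proof -
  let ?C = "{X :: 'a ^ 'n ^ 'n. supported P X}" and ?K = "{X. f X = 0}"
  let ?u = "\<lambda>e. munit (fst e) (snd e) :: 'a ^ 'n ^ 'n"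
  have C: "mat_vs.subspace ?C"
    by (intro mat_vs.subspaceI) (simp_all add: supported_def)
  have "card (?u ` P) \<le> mat_vs.dim ?C"
  proof (rule mat_fd.independent_card_le_dim)
    show "?u ` P \<subseteq> ?C"
      by (auto simp: supported_def munit_nth)
    show "mat_vs.independent (?u ` P)"
      by (rule mat_vs.independent_mono[OF mat_fd.independent_Basis]) auto
  qed
  then have "card P \<le> mat_vs.dim ?C"
    by (simp add: card_image inj_on_subset[OF inj_munit])
  moreover have "?C \<inter> ?K = {0}"
    using inj by (auto simp: inj_supported_def supported_def mat_linear_0[OF lin])
  then have "mat_vs.dim {X + Y |X Y. X \<in> ?C \<and> Y \<in> ?K} = mat_vs.dim ?C + mat_vs.dim ?K"
    using mat_fd.dim_sums_Int[OF C subspace_kernel[OF lin]] by simp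
  moreover have "mat_vs.dim {X + Y |X Y. X \<in> ?C \<and> Y \<in> ?K} \<le> CARD('n) ^ 2"
    unfolding dim_mat_UNIV[where 'a = 'a, symmetric] by (rule mat_fd.dim_subset) simp
  ultimately show ?thesis
    by (simp add: nullity_def)
qed

text \<open>A repeated letter kills the standard polynomial, so every member of \<open>As\<close>
  lies in the kernel. If one were a combination of the others, linearity in its place would make the
  operator vanish at \<open>X\<close> as well.\<close>

lemma nullity_ge:
  fixes As :: "('a::field ^ 'n::finite ^ 'n) list"
  assumes nz: "stp (As @ [X]) \<noteq> 0"
  shows "length As \<le> nullity (\<lambda>X. stp (As @ [X]))"
proof -
  have dist: "distinct As"
    using nz stp_not_distinct[of "As @ [X]"] by auto
  have "mat_vs.independent (set As)"
  proof
    assume "mat_vs.dependent (set As)"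
    then obtain A where A: "A \<in> set As" "A \<in> mat_vs.span (set As - {A})"
      by (auto simp: mat_vs.dependent_def)
    then obtain xs ys where As: "As = xs @ A # ys"
      by (meson split_list)
    let ?f = "\<lambda>Y. stp (xs @ Y # ys @ [X])"
    have "mat_linear ?f"
      by (simp add: mat_linear_def stp_linear)
    then have "mat_vs.subspace {Y. ?f Y = 0}"
      by (rule subspace_kernel)
    moreover have "set As - {A} \<subseteq> {Y. ?f Y = 0}"
    proof
      fix Y
      assume "Y \<in> set As - {A}"
      then have "\<not> distinct (xs @ Y # ys @ [X])"
        by (auto simp: As)
      then show "Y \<in> {Y. ?f Y = 0}"
        by (simp add: stp_not_distinct)
    qed
    ultimately have "mat_vs.span (set As - {A}) \<subseteq> {Y. ?f Y = 0}"
      by (intro mat_vs.span_minimal)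
    with A(2) have "?f A = 0"
      by blast
    then show False
      using nz by (simp add: As)
  qed
  moreover have "set As \<subseteq> {X. stp (As @ [X]) = 0}"
    by (auto intro!: stp_not_distinct)
  ultimately have "card (set As) \<le> nullity (\<lambda>X. stp (As @ [X]))"
    unfolding nullity_def by (intro mat_fd.independent_card_le_dim)
  then show ?thesis
    by (simp add: distinct_card[OF dist])
qed

theorem theorem1p2:
  fixes r k :: nat
  assumes "k = 2 * r" and "k > 0"
    and "infinite (UNIV :: 'a::field set)"
    and "\<not> CHAR('a) dvd 2 * (2 * r + 1) * fact r"
    and "CARD('n::finite) > r"
  shows "in_general_position k (\<lambda>As :: ('a ^ 'n ^ 'n) list. nullity (L_op As) = k)"
proof -
  have r: "0 < r"
    using assms(1,2) by simp
  have "\<not> CHAR('a) dvd 2"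
    using assms(4) by (meson dvd_mult2)
  then have two: "(2 :: 'a) \<noteq> 0"
    using of_nat_eq_0_iff_char_dvd[of 2, where 'a = 'a] by simp
  \<comment> \<open>For \<open>r = 1\<close> the factor \<open>2 * r + 1\<close> is 3.\<close>
  have three: "(3 :: 'a) \<noteq> 0" if "r = 1"
  proof -
    have "\<not> CHAR('a) dvd 2 * r + 1"
      using assms(4) by (meson dvd_mult dvd_mult2)
    then have "\<not> CHAR('a) dvd 3"
      by (simp add: that)
    then show ?thesis
      using of_nat_eq_0_iff_char_dvd[of 3, where 'a = 'a] by simp
  qed
  obtain As0 :: "('a ^ 'n ^ 'n) list" and P where As0: "length As0 = k"
    "inj_supported P (\<lambda>X. stp (As0 @ [X]))" and P: "card P + k = CARD('n) ^ 2"
    using rank_attained_UNIV[OF assms(3) two three r assms(5)] unfolding rank_attained_def assms(1) by blast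
  let ?\<Phi> = "\<lambda>(As :: ('a ^ 'n ^ 'n) list) X. stp ([] @ map (\<lambda>j. As ! j) [0..<k] @ [X])"
  have \<Phi>: "?\<Phi> As = (\<lambda>X. stp (As @ [X]))" if "length As = k" for As
    using map_nth[of As] that by simp
  have "\<exists>p\<in>mat_poly_fun k. p As0 \<noteq> 0 \<and> (\<forall>As. p As \<noteq> 0 \<longrightarrow> inj_supported P (?\<Phi> As))"
  proof (rule inj_supported_generic[OF fun_ring_mat_poly_fun])
    show "mat_linear (?\<Phi> As)" for As
      using mat_linear_stp by simp
    show "mat_fun (mat_poly_fun k) (\<lambda>As. ?\<Phi> As X)" for X
      by (rule mat_fun_stp_nth) auto
    show "inj_supported P (?\<Phi> As0)"
      using As0 by (simp only: \<Phi>)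
  qed
  then obtain p where p: "p \<in> mat_poly_fun k" "p As0 \<noteq> 0"
    "\<And>As. p As \<noteq> 0 \<Longrightarrow> inj_supported P (?\<Phi> As)"
    by blast
  define U where "U = {As \<in> mat_tuples k. p As \<noteq> 0}"
  have "mat_tuples k - U = {As \<in> mat_tuples k. \<forall>q\<in>{p}. q As = 0}"
    by (auto simp: U_def)
  then have "zariski_open k U"
    using p(1) unfolding zariski_open_def zariski_closed_def
    by (intro conjI exI[of _ "{p}"]) (auto simp: U_def)
  moreover have "U \<noteq> {}"
    using As0 p(2) by (auto simp: U_def mat_tuples_def)
  moreover have "nullity (L_op As) = k" if "As \<in> U" for As
  proof -
    have len: "length As = k"
      using that by (simp add: U_def mat_tuples_def)
    have inj: "inj_supported P (\<lambda>X. stp (As @ [X]))"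
      using p(3)[of As] that by (simp only: \<Phi>[OF len] U_def) simp
    \<comment> \<open>As \<open>CARD('n) > r\<close>, the number \<open>card P\<close> is positive;
      this gives a matrix outside the kernel, as \<open>nullity_ge\<close> needs.\<close>
    have "2 * r < Suc r * Suc r"
      by simp
    also have "\<dots> \<le> CARD('n) ^ 2"
      unfolding power2_eq_square using assms(5) by (intro mult_le_mono) simp_all
    finally have "card P \<noteq> 0"
      using P assms(1) by linarith
    then have "P \<noteq> {}"
      by auto
    then obtain e where "e \<in> P"
      by blast
    then have "supported P (munit (fst e) (snd e) :: 'a ^ 'n ^ 'n)"
      by (auto simp: supported_def munit_nth)
    moreover have "(munit (fst e) (snd e) :: 'a ^ 'n ^ 'n) \<noteq> 0"
      by (auto simp: vec_eq_iff munit_nth)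
    ultimately have "stp (As @ [munit (fst e) (snd e)]) \<noteq> 0"
      using inj by (auto simp: inj_supported_def)
    from nullity_ge[OF this] have "k \<le> nullity (\<lambda>X. stp (As @ [X]))"
      by (simp add: len)
    moreover have "nullity (\<lambda>X. stp (As @ [X])) \<le> k"
      using nullity_le[OF mat_linear_stp inj] P by linarith
    ultimately show ?thesis
      by (simp add: L_op_def[abs_def])
  qed
  ultimately show ?thesis
    unfolding in_general_position_def by blast
qed

end
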